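(* Let $\mathcal A=\{H_j=\ker\ell_j\}_{j=1}^m$ be an essential central arrangement of distinct real hyperplanes in $\mathbb R^n$ (the $\ell_j$ being nonzero real linear forms). Let $0<\lambda_j<1$ satisfy $$\sum_{j=1}^m\lambda_j=n,$$ and suppose that every nonzero proper intersection flat $X$ of $\mathcal A$ satisfies $$\sum_{j:\,H_j\supset X}\lambda_j<\operatorname{codim}X.$$ For a chamber $D$ of $\mathcal A$, put $$P_D=\int_{D\cap S^{n-1}}\prod_{j=1}^m|\ell_j(x)|^{-\lambda_j}\,\iota_E(dx_1\wedge\cdots\wedge dx_n),\qquad E=\sum_{k=1}^n x_k\partial_{x_k}.$$ Let $a_j=e^{\pi i\lambda_j}$, and define the matrix $V(a)$, with rows and columns indexed by the chambers of $\mathcal A$, by $$V(a)_{C,D}=\prod_{H_j\in\operatorname{Sep}(C,D)}a_j .$$ Then every $P_D$ is finite and positive, and the chamber-period vector $P=(P_D)_D$ satisfies $$V(a)P=0.$$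
   Context: A chamber is a connected component of $\mathbb R^n\setminus\bigcup_jH_j$. An intersection flat is an intersection of hyperplanes of $\mathcal A$; it is nonzero and proper if it is neither $\{0\}$ nor $\mathbb R^n$. $\operatorname{Sep}(C,D)$ is the set of hyperplanes of $\mathcal A$ that separate $C$ from $D$ (the empty product is $1$). The form $\iota_E(dx_1\wedge\cdots\wedge dx_n)$ restricted to the unit sphere $S^{n-1}$, with its outward (boundary) orientation, is the standard positive spherical measure. *)

theory Defs
  imports "HOL-Analysis.Analysis"
begin

definition hyperplane :: "('j \<Rightarrow> 'a::real_vector \<Rightarrow> real) \<Rightarrow> 'j \<Rightarrow> 'a set" where
  "hyperplane l j = {x. l j x = 0}"

definition arrangement :: "(nat \<Rightarrow> 'a::real_vector \<Rightarrow> real) \<Rightarrow> nat \<Rightarrow> 'a set set" where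
  "arrangement l m = hyperplane l ` {1..m}"

definition essential :: "'a::real_vector set set \<Rightarrow> bool" where
  "essential \<A> \<longleftrightarrow> \<Inter>\<A> = {0}"

definition chambers :: "'a::topological_space set set \<Rightarrow> 'a set set" where
  "chambers \<A> = components (UNIV - \<Union>\<A>)"

text \<open>The empty intersection is the whole space.\<close>

definition intersection_flats :: "'a set set \<Rightarrow> 'a set set" where
  "intersection_flats \<A> = {\<Inter>\<B> |\<B>. \<B> \<subseteq> \<A>}"

definition codim :: "(real^'n) set \<Rightarrow> nat" where
  "codim X = CARD('n) - dim X"

definition separates :: "'a::real_vector set \<Rightarrow> 'a set \<Rightarrow> 'a set \<Rightarrow> bool" where
  "separates H C D \<longleftrightarrow>
     (\<exists>f::'a \<Rightarrow> real. linear f \<and> H = {x. f x = 0} \<and> (\<forall>x\<in>C. f x < 0) \<and> (\<forall>x\<in>D. f x > 0))"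

definition Sep :: "'a::real_vector set set \<Rightarrow> 'a set \<Rightarrow> 'a set \<Rightarrow> 'a set set" where
  "Sep \<A> C D = {H \<in> \<A>. separates H C D}"

definition V_matrix ::
  "(nat \<Rightarrow> 'a::real_vector \<Rightarrow> real) \<Rightarrow> nat \<Rightarrow> (nat \<Rightarrow> complex) \<Rightarrow> 'a set \<Rightarrow> 'a set \<Rightarrow> complex" where
  "V_matrix l m a C D = (\<Prod>j\<in>{j\<in>{1..m}. hyperplane l j \<in> Sep (arrangement l m) C D}. a j)"

text \<open>The standard (surface) measure on the unit sphere, as a Borel measure on the ambient space:
  the measure of \<open>A\<close> is \<open>n\<close> times the Lebesgue measure of the cone
  \<open>{x. 0 < norm x \<le> 1 \<and> x / norm x \<in> A}\<close> (\<open>sgn x\<close> is the unit vector \<open>x / norm x\<close>).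
  It is the measure given by the form \<open>\<iota>\<^sub>E(dx\<^sub>1 \<and> \<dots> \<and> dx\<^sub>n)\<close> with the outward orientation; see
  \<open>emeasure_spherical_measure_chart\<close> below.\<close>

definition spherical_measure :: "(real^'n) measure" where
  "spherical_measure =
     distr (density lborel (\<lambda>x. of_nat CARD('n) * indicator (cball 0 1) x)) borel sgn"

definition chamber_period ::
  "(nat \<Rightarrow> real^'n \<Rightarrow> real) \<Rightarrow> (nat \<Rightarrow> real) \<Rightarrow> nat \<Rightarrow> (real^'n) set \<Rightarrow> ennreal" where
  "chamber_period l lam m D =
     (\<integral>\<^sup>+x\<in>D \<inter> sphere 0 1. ennreal (\<Prod>j=1..m. \<bar>l j x\<bar> powr (- lam j)) \<partial>spherical_measure)"

text \<open>Hence sums over the chambers are genuine finite sums.\<close>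

lemma finite_chambers:
  fixes l :: "nat \<Rightarrow> 'a::real_normed_vector \<Rightarrow> real"
  assumes lin: "\<And>j. j \<in> {1..m} \<Longrightarrow> linear (l j)"
  shows "finite (chambers (arrangement l m))"
proof -
  let ?K = "UNIV - \<Union>(arrangement l m)"
  define pt where "pt = (\<lambda>D::'a set. SOME x. x \<in> D)"
  define sg where "sg = (\<lambda>D. {j\<in>{1..m}. l j (pt D) > 0})"
  have pt: "pt D \<in> D" if "D \<in> components ?K" for D
    unfolding pt_def using in_components_nonempty[OF that] by (simp add: some_in_eq)
  have nz: "l j x \<noteq> 0" if "x \<in> ?K" "j \<in> {1..m}" for j x
    using that by (auto simp: arrangement_def hyperplane_def)
  have "inj_on sg (components ?K)"
  proof (rule inj_onI)
    fix D D' assume D: "D \<in> components ?K" "D' \<in> components ?K" "sg D = sg D'"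
    let ?x = "pt D" and ?y = "pt D'"
    have K: "?x \<in> ?K" "?y \<in> ?K" using D pt in_components_subset by blast+
    have "closed_segment ?x ?y \<subseteq> ?K"
    proof (clarsimp simp: arrangement_def hyperplane_def)
      fix z j assume z: "z \<in> closed_segment ?x ?y" and j: "Suc 0 \<le> j" "j \<le> m" "l j z = 0"
      from z obtain t where t: "0 \<le> t" "t \<le> 1" "z = (1 - t) *\<^sub>R ?x + t *\<^sub>R ?y"
        by (auto simp: in_segment)
      have jm: "j \<in> {1..m}" using j by auto
      have e: "(1 - t) * l j ?x + t * l j ?y = 0"
        using j(3) t(3) lin[OF jm] by (simp add: linear_add linear_scale)
      have "l j ?x > 0 \<longleftrightarrow> l j ?y > 0" using D(3) jm unfolding sg_def by blast
      with nz[OF K(1) jm] nz[OF K(2) jm]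
      consider "l j ?x > 0" "l j ?y > 0" | "l j ?x < 0" "l j ?y < 0" by linarith
      then show False
      proof cases
        case 1
        then have "(1 - t) * l j ?x \<ge> 0" "t * l j ?y \<ge> 0" using t by auto
        with e have "(1 - t) * l j ?x = 0" "t * l j ?y = 0" by linarith+
        then show False using 1 by auto
      next
        case 2
        then have "(1 - t) * l j ?x \<le> 0" "t * l j ?y \<le> 0"
          using t by (auto simp: mult_le_0_iff)
        with e have "(1 - t) * l j ?x = 0" "t * l j ?y = 0" by linarith+
        then show False using 2 by auto
      qed
    qed
    then have "closed_segment ?x ?y \<subseteq> D"
      using D(1) pt[OF D(1)] by (intro components_maximal[of D ?K]) auto
    then have "D \<inter> D' \<noteq> {}" using pt[OF D(2)] by auto
    then show "D = D'" using components_nonoverlap[OF D(1,2)] by blast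
  qed
  moreover have "finite (sg ` components ?K)"
    by (rule finite_subset[of _ "Pow {1..m}"]) (auto simp: sg_def)
  ultimately show ?thesis unfolding chambers_def by (rule finite_imageD[rotated])
qed

text \<open>The value at \<open>x\<close> of \<open>\<iota>\<^sub>E(dx\<^sub>1 \<and> \<dots> \<and> dx\<^sub>n)\<close> on the vectors \<open>v q\<close>, that is
  \<open>det (x, v\<^sub>1, \<dots>, v\<^bsub>n-1\<^esub>)\<close>.  The bijection \<open>b\<close> assigns the columns; it only affects the sign.\<close>

definition euler_form ::
  "('n \<Rightarrow> 'm option) \<Rightarrow> real^'n \<Rightarrow> ('m \<Rightarrow> real^'n) \<Rightarrow> real" where
  "euler_form b x v = det (\<chi> i j. (case b j of None \<Rightarrow> x | Some r \<Rightarrow> v r) $ i)"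

lemma det_cols_mul:
  fixes A :: "real^'n^'n"
  shows "det (\<chi> i j. c j * A $ i $ j) = prod c UNIV * det A"
proof -
  have "det (\<chi> i j. c j * A $ i $ j) = det (transpose (\<chi> i j. c j * A $ i $ j))"
    by (simp add: det_transpose)
  also have "transpose (\<chi> i j. c j * A $ i $ j) = (\<chi> i. c i *s (transpose A $ i))"
    by (simp add: transpose_def vec_eq_iff)
  also have "det \<dots> = prod c UNIV * det (transpose A)"
    using det_rows_mul[of c "\<lambda>i. transpose A $ i"] by (simp add: vec_lambda_eta)
  finally show ?thesis by (simp add: det_transpose)
qed

lemma distr_join_lborel:
  fixes b :: "'n::finite \<Rightarrow> 'm::finite option"
  assumes b: "bij b"
  defines "T \<equiv> \<lambda>(r::real, u::real^'m). (\<chi> j. case b j of None \<Rightarrow> r | Some q \<Rightarrow> u $ q) :: real^'n"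
  shows "T \<in> borel_measurable borel" "distr (lborel \<Otimes>\<^sub>M lborel) borel T = lborel"
proof -
  show T: "T \<in> borel_measurable borel"
  proof (rule borel_measurable_continuous_onI)
    have "continuous_on UNIV (\<lambda>x. (\<chi> j. case b j of None \<Rightarrow> fst x | Some q \<Rightarrow> snd x $ q) :: real^'n)"
      apply (intro continuous_intros)
      subgoal for j by (cases "b j") (auto intro!: continuous_intros)
      done
    then show "continuous_on UNIV T" by (simp add: T_def case_prod_unfold)
  qed
  have reidx: "(\<Prod>j\<in>UNIV. case b j of None \<Rightarrow> g | Some q \<Rightarrow> h q) = g * (\<Prod>q\<in>UNIV. h q)"
    for g :: ennreal and h
  proof -
    have "(\<Prod>j\<in>UNIV. case b j of None \<Rightarrow> g | Some q \<Rightarrow> h q) =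
          (\<Prod>o'\<in>UNIV. case o' of None \<Rightarrow> g | Some q \<Rightarrow> h q)"
      using b by (intro prod.reindex_bij_betw) 
    also have "\<dots> = g * (\<Prod>q\<in>UNIV. h q)"
      by (simp add: UNIV_option_conv prod.insert prod.reindex inj_Some)
    finally show ?thesis .
  qed
  show "distr (lborel \<Otimes>\<^sub>M lborel) borel T = lborel"
  proof (rule lborel_eqI[symmetric])
    fix l u :: "real^'n" assume "\<And>b. b \<in> Basis \<Longrightarrow> l \<bullet> b \<le> u \<bullet> b"
    then have le: "l $ j \<le> u $ j" for j
      by (metis axis_in_Basis_iff cart_eq_inner_axis insertI1 real_inner_1_right Basis_real_def)
    let ?k = "inv b None" and ?e = "\<lambda>q. inv b (Some q)"
    have bk: "b (inv b z) = z" for z using b by (simp add: bij_is_surj surj_f_inv_f)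
    have kb: "inv b (b z) = z" for z using b by (simp add: bij_is_inj)
    have split: "(\<forall>j. P j) \<longleftrightarrow> P ?k \<and> (\<forall>q. P (?e q))" for P
      by (metis kb option.exhaust)
    have "T -` box l u = box (l $ ?k) (u $ ?k) \<times> box (\<chi> q. l $ ?e q) (\<chi> q. u $ ?e q)"
      by (auto simp: T_def mem_box_cart split bk box_real)
    moreover have "emeasure (distr (lborel \<Otimes>\<^sub>M lborel) borel T) (box l u) = 
        emeasure (lborel \<Otimes>\<^sub>M lborel) (T -` box l u)"
      using T by (subst emeasure_distr) (simp_all add: lborel_prod)
    ultimately have "emeasure (distr (lborel \<Otimes>\<^sub>M lborel) borel T) (box l u) =
       emeasure lborel (box (l $ ?k) (u $ ?k)) * emeasure lborel (box (\<chi> q. l $ ?e q) (\<chi> q. u $ ?e q))"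
      by (simp only:) (subst lborel.emeasure_pair_measure_Times, auto)
    also have "\<dots> = ennreal (u $ ?k - l $ ?k) * (\<Prod>q\<in>UNIV. ennreal (u $ ?e q - l $ ?e q))"
      using le by (simp add: emeasure_lborel_box_eq Basis_vec_def inner_axis prod.UNION_disjoint
         axis_eq_axis UNION_singleton_eq_range prod.reindex inj_on_def prod_ennreal)
    also have "\<dots> = (\<Prod>j\<in>UNIV. case b j of None \<Rightarrow> ennreal (u $ ?k - l $ ?k) 
          | Some q \<Rightarrow> ennreal (u $ ?e q - l $ ?e q))" by (simp add: reidx)
    also have "\<dots> = (\<Prod>j\<in>UNIV. ennreal ((u - l) $ j))"
      by (intro prod.cong refl) (auto split: option.split simp: kb dest!: arg_cong[where f="inv b"])
    also have "\<dots> = ennreal (\<Prod>j\<in>UNIV. (u - l) $ j)"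
      using le by (simp add: prod_ennreal)
    also have "(\<Prod>j\<in>UNIV. (u - l) $ j) = (\<Prod>b\<in>Basis. (u - l) \<bullet> b)"
      by (simp add: Basis_vec_def inner_axis axis_eq_axis UNION_singleton_eq_range prod.reindex inj_on_def)
    finally show "emeasure (distr (lborel \<Otimes>\<^sub>M lborel) borel T) (box l u) = (\<Prod>b\<in>Basis. (u - l) \<bullet> b)" .
  qed simp
qed


lemma emeasure_spherical_measure:
  assumes "A \<in> sets borel"
  shows "emeasure spherical_measure A =
     of_nat CARD('n) * emeasure lborel (cball 0 1 \<inter> sgn -` A :: (real^'n) set)"
proof -
  have [measurable]: "sgn \<in> borel_measurable (borel :: (real^'n) measure)" by measurable
  have [measurable]: "A \<in> sets borel" by fact
  have sA [measurable]: "sgn -` A \<in> sets (borel :: (real^'n) measure)"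
    using measurable_sets[OF \<open>sgn \<in> _\<close> assms] by simp
  have dm: "(\<lambda>x. of_nat CARD('n) * indicator (cball 0 1) x :: ennreal) \<in>
      borel_measurable (lborel :: (real^'n) measure)"
    by (intro borel_measurable_times_ennreal borel_measurable_indicator) auto
  have "emeasure spherical_measure A =
     (\<integral>\<^sup>+x. of_nat CARD('n) * indicator (cball 0 1) x * indicator (sgn -` A) x \<partial>(lborel::(real^'n) measure))"
    unfolding spherical_measure_def 
    using sA assms by (subst emeasure_distr) (simp_all add: emeasure_density[OF dm])
  also have "\<dots> = (\<integral>\<^sup>+x. of_nat CARD('n) * indicator (cball 0 1 \<inter> sgn -` A) x \<partial>(lborel::(real^'n) measure))"
    by (intro nn_integral_cong) (auto split: split_indicator)
  also have "\<dots> = of_nat CARD('n) * emeasure lborel (cball 0 1 \<inter> sgn -` A :: (real^'n) set)"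
    using sA by (subst nn_integral_cmult) (auto intro!: borel_measurable_indicator)
  finally show ?thesis .
qed

text \<open>Integrating the Euler contraction over a positively oriented chart gives the spherical
  measure: \<open>\<phi>\<close> is a \<open>C\<^sup>1\<close> parametrization of an open piece of the sphere,
  and \<open>\<phi>' u (axis q 1)\<close> is its \<open>q\<close>-th partial derivative at \<open>u\<close>.
  For the outward orientation the form is nonnegative on positively oriented frames, so the
  absolute value only discards the order of the parameters.  The sort constraint is that
  of the change-of-variables theorem.\<close>

lemma emeasure_spherical_measure_chart:
  fixes \<phi> :: "real^'m \<Rightarrow> real^'n::{finite,wellorder}" and b :: "'n \<Rightarrow> 'm option"
  assumes b: "bij b" and U: "open U" and V: "V \<subseteq> U" "V \<in> sets borel" "\<phi> ` V \<in> sets borel"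
    and sph: "\<phi> ` U \<subseteq> sphere 0 1" and inj: "inj_on \<phi> U"
    and der: "\<And>u. u \<in> U \<Longrightarrow> (\<phi> has_derivative \<phi>' u) (at u)"
    and cont: "\<And>q. continuous_on U (\<lambda>u. \<phi>' u (axis q 1))"
  shows "emeasure spherical_measure (\<phi> ` V) =
    (\<integral>\<^sup>+u\<in>V. ennreal \<bar>euler_form b (\<phi> u) (\<lambda>q. \<phi>' u (axis q 1))\<bar> \<partial>lborel)"
proof -
  define k where "k = inv b None"
  define e where "e = (\<lambda>q. inv b (Some q))"
  define p :: "real^'n::_ \<Rightarrow> real^'m" where "p = (\<lambda>y. \<chi> q. y $ e q)"
  define W where "W = (\<lambda>u. \<bar>euler_form b (\<phi> u) (\<lambda>q. \<phi>' u (axis q 1))\<bar>)"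
  define S where "S = {y. 0 < y $ k \<and> y $ k \<le> 1 \<and> p y \<in> V}"
  define \<Phi> where "\<Phi> = (\<lambda>y. (y $ k) *\<^sub>R \<phi> (p y))"
  define \<Phi>' where "\<Phi>' = (\<lambda>y h. (y $ k) *\<^sub>R \<phi>' (p y) (p h) + (h $ k) *\<^sub>R \<phi> (p y))"
  define T where "T = (\<lambda>(r::real, u::real^'m). (\<chi> j. case b j of None \<Rightarrow> r | Some q \<Rightarrow> u $ q) :: real^'n::_)"
  note T = distr_join_lborel[OF b, folded T_def]
  have bk: "b k = None" "b (e q) = Some q" for q
    using b by (simp_all add: k_def e_def bij_is_surj surj_f_inv_f)
  have kb: "j = k \<or> (\<exists>q. j = e q)" for j
    using b unfolding k_def e_def by (metis bij_inv_eq_iff option.exhaust)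
  have ne: "k \<noteq> e q" "e q = e q' \<longleftrightarrow> q = q'" for q q'
    by (metis bk option.distinct(1)) (metis bk option.inject)
  have card: "CARD('n) = CARD('m) + 1"
    using bij_betw_same_card[OF b] by (simp add: card_UNIV_option)
  have Tk: "T (r, u) $ k = r" "p (T (r, u)) = u" for r u
    by (simp_all add: T_def p_def bk vec_eq_iff)
  have blp: "bounded_linear p"
    unfolding p_def by (intro linear_conv_bounded_linear[THEN iffD1] linearI) (auto simp: vec_eq_iff)
  have [measurable]: "p \<in> borel_measurable borel"
    using blp by (intro borel_measurable_continuous_onI linear_continuous_on)
  have nrm: "norm (\<phi> u) = 1" if "u \<in> V" for u proof -
    have "\<phi> u \<in> sphere 0 1" using sph V that by blast
    then show ?thesis by simp
  qed
  have [measurable]: "V \<in> sets borel" by fact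
  have S_borel [measurable]: "S \<in> sets borel" unfolding S_def by measurable
  have cone: "cball 0 1 \<inter> sgn -` (\<phi> ` V) = \<Phi> ` S"
  proof (intro equalityI subsetI)
    fix x assume "x \<in> cball 0 1 \<inter> sgn -` (\<phi> ` V)"
    then obtain u where u: "u \<in> V" "sgn x = \<phi> u" "norm x \<le> 1" by auto
    then have "x \<noteq> 0" using nrm[of u] by auto
    then have "x = \<Phi> (T (norm x, u))"
      using u by (simp add: \<Phi>_def Tk flip: u(2)) (simp add: sgn_div_norm)
    moreover have "T (norm x, u) \<in> S" using u \<open>x \<noteq> 0\<close> by (simp add: S_def Tk)
    ultimately show "x \<in> \<Phi> ` S" by blast
  next
    fix x assume "x \<in> \<Phi> ` S"
    then obtain y where y: "y \<in> S" "x = \<Phi> y" by auto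
    then have "sgn x = \<phi> (p y)" "norm x \<le> 1"
      using nrm[of "p y"] by (auto simp: \<Phi>_def S_def sgn_scaleR sgn_div_norm)
    then show "x \<in> cball 0 1 \<inter> sgn -` (\<phi> ` V)" using y by (auto simp: S_def)
  qed
  have injS: "inj_on \<Phi> S"
  proof (rule inj_onI)
    fix y z assume yz: "y \<in> S" "z \<in> S" "\<Phi> y = \<Phi> z"
    have nk: "norm (\<Phi> y) = y $ k" if "y \<in> S" for y
      using that nrm[of "p y"] by (auto simp: \<Phi>_def S_def)
    have "norm (\<Phi> y) = y $ k" "norm (\<Phi> z) = z $ k"
      using yz(1,2) nk by blast+
    with yz have k: "y $ k = z $ k" by metis
    with yz have "\<phi> (p y) = \<phi> (p z)" by (auto simp: \<Phi>_def S_def)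
    with yz inj V have "p y = p z" by (auto simp: S_def inj_on_def)
    with k show "y = z" by (metis (no_types, lifting) kb p_def vec_eq_iff vec_lambda_beta)
  qed
  have derS: "(\<Phi> has_derivative \<Phi>' y) (at y within S)" if "y \<in> S" for y
  proof -
    have "(\<phi> has_derivative \<phi>' (p y)) (at (p y))" using that V by (intro der) (auto simp: S_def)
    from has_derivative_compose[OF bounded_linear_imp_has_derivative[OF blp] this]
    have "((\<lambda>y. \<phi> (p y)) has_derivative (\<lambda>h. \<phi>' (p y) (p h))) (at y)" .
    from has_derivative_scaleR[OF bounded_linear_imp_has_derivative[OF bounded_linear_vec_nth] this, of k]
    have "(\<Phi> has_derivative \<Phi>' y) (at y)"
      unfolding \<Phi>_def \<Phi>'_def .
    then show ?thesis by (rule has_derivative_at_withinI)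
  qed
  have detS: "\<bar>det (matrix (\<Phi>' y))\<bar> = (y $ k) ^ CARD('m) * W (p y)" if "y \<in> S" for y
  proof -
    let ?M = "\<chi> i j. (case b j of None \<Rightarrow> \<phi> (p y) | Some r \<Rightarrow> \<phi>' (p y) (axis r 1)) $ i"
    let ?c = "\<lambda>j. if j = k then 1 else y $ k"
    have "linear (\<phi>' (p y))" using der[of "p y"] that V
      by (auto simp: S_def intro: has_derivative_linear)
    then have z: "\<phi>' (p y) 0 = 0" by (rule linear_0)
    have pa: "p (axis k 1) = 0" "p (axis (e q) 1) = axis q 1" for q
      by (auto simp: p_def vec_eq_iff axis_def ne ne(1)[symmetric])
    have "\<Phi>' y (axis j 1) $ i = ?c j * ?M $ i $ j" for i j
    proof -
      have "axis k 1 $ k = (1::real)" "axis (e q) 1 $ k = (0::real)" for q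
        using ne(1) by (auto simp: axis_def)
      then show ?thesis using kb[of j] ne(1) by (auto simp: \<Phi>'_def pa z bk)
    qed
    then have "matrix (\<Phi>' y) = (\<chi> i j. ?c j * ?M $ i $ j)"
      by (simp add: matrix_def vec_eq_iff)
    then have "det (matrix (\<Phi>' y)) = prod ?c UNIV * det ?M"
      by (simp only: det_cols_mul)
    also have "prod ?c UNIV = (y $ k) ^ CARD('m)"
      by (subst prod.remove[of _ k]) (auto simp: card)
    finally show ?thesis using that by (simp add: W_def euler_form_def abs_mult S_def)
  qed
  have Wm: "(\<lambda>u. indicator V u *\<^sub>R W u) \<in> borel_measurable borel"
  proof -
    have "continuous_on U \<phi>"
      using der by (meson continuous_at_imp_continuous_on has_derivative_continuous)
    then have "continuous_on U W"
      unfolding W_def euler_form_def det_def vec_lambda_beta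
      apply (intro continuous_intros)
      subgoal for s j using cont by (cases "b (s j)") (auto intro!: continuous_intros)
      done
    then show ?thesis using V
      by (intro borel_measurable_continuous_on_indicator) (auto intro: continuous_on_subset)
  qed
  then have Wm' [measurable]: "(\<lambda>u. indicator V u * W u) \<in> borel_measurable borel" by simp
  have W0: "0 \<le> W u" for u by (simp add: W_def)
  define f where "f = (\<lambda>y::real^'n::_. indicator {0<..1} (y $ k) * (y $ k) ^ CARD('m) * (indicator V (p y) * W (p y)))"
  have fm [measurable]: "f \<in> borel_measurable borel"
  proof -
    have "(\<lambda>y. indicator V (p y) * W (p y)) \<in> borel_measurable borel"
      by (rule measurable_compose[OF _ Wm']) measurable
    then show ?thesis unfolding f_def by measurable
  qed
  have f0: "0 \<le> f y" for y by (auto simp: f_def W0 split: split_indicator)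
  have img: "\<Phi> ` S \<in> sets borel"
  proof -
    have "sgn -` (\<phi> ` V) \<in> sets (borel :: (real^'n::_) measure)"
      using measurable_sets[of sgn "borel :: (real^'n::_) measure" borel "\<phi> ` V"] V by simp
    then show ?thesis by (simp flip: cone)
  qed
  moreover have "bounded (\<Phi> ` S)"
    by (rule bounded_subset[of "cball 0 1"]) (auto simp flip: cone)
  ultimately have lm: "\<Phi> ` S \<in> lmeasurable" by (auto intro: bounded_set_imp_lmeasurable)
  have "((\<lambda>y. \<bar>det (matrix (\<Phi>' y))\<bar>) has_integral measure lebesgue (\<Phi> ` S)) S"
    using has_measure_differentiable_image[OF _ derS injS, of "measure lebesgue (\<Phi> ` S)"] lm by auto
  then have "((\<lambda>y. if y \<in> S then \<bar>det (matrix (\<Phi>' y))\<bar> else 0) has_integral measure lebesgue (\<Phi> ` S)) UNIV"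
    by (simp only: has_integral_restrict_UNIV)
  also have "(\<lambda>y. if y \<in> S then \<bar>det (matrix (\<Phi>' y))\<bar> else 0) = f"
    using detS by (auto simp: f_def S_def fun_eq_iff split: split_indicator)
  finally have "(\<integral>\<^sup>+y. f y \<partial>lborel) = measure lebesgue (\<Phi> ` S)"
    using fm f0 by (intro nn_integral_has_integral_lborel) auto
  also have "ennreal (measure lebesgue (\<Phi> ` S)) = emeasure lebesgue (\<Phi> ` S)"
    using lm by (intro emeasure_eq_ennreal_measure[symmetric]) (auto simp: fmeasurable_def)
  also have "\<dots> = emeasure lborel (\<Phi> ` S)" using img by simp
  finally have 1: "emeasure lborel (\<Phi> ` S) = (\<integral>\<^sup>+y. f y \<partial>lborel)" ..
  have Tm: "T \<in> measurable (lborel \<Otimes>\<^sub>M lborel) borel"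
    using T(1) by (simp add: lborel_prod)
  have "(\<integral>\<^sup>+y. f y \<partial>lborel) = (\<integral>\<^sup>+z. f (T z) \<partial>(lborel \<Otimes>\<^sub>M lborel))"
    by (subst T(2)[symmetric], subst nn_integral_distr[OF Tm]) auto
  also have "\<dots> = (\<integral>\<^sup>+r. \<integral>\<^sup>+u. f (T (r, u)) \<partial>lborel \<partial>lborel)"
    by (subst lborel.nn_integral_fst[symmetric])
       (auto intro!: measurable_compose[OF Tm])
  also have "\<dots> = (\<integral>\<^sup>+r. \<integral>\<^sup>+u. ennreal (indicator {0<..1} r * r ^ CARD('m)) * ennreal (indicator V u * W u) \<partial>lborel \<partial>lborel)"
    by (intro nn_integral_cong) (auto simp: f_def Tk W0 ennreal_mult[symmetric] split: split_indicator)
  also have "\<dots> = (\<integral>\<^sup>+r. ennreal (indicator {0<..1} r * r ^ CARD('m)) \<partial>lborel) *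
      (\<integral>\<^sup>+u. ennreal (indicator V u * W u) \<partial>lborel)"
    by (simp add: nn_integral_cmult nn_integral_multc)
  also have "(\<integral>\<^sup>+r. ennreal (indicator {0<..1} r * r ^ CARD('m)) \<partial>lborel)
     = (\<integral>\<^sup>+r. ennreal (r ^ CARD('m)) * indicator {0..1} r \<partial>lborel)"
    by (intro nn_integral_cong) (auto split: split_indicator simp: zero_less_iff_neq_zero)
  also have "\<dots> = ennreal (1 ^ CARD('n) / CARD('n) - 0 ^ CARD('n) / CARD('n))"
    by (rule nn_integral_FTC_Icc[where F = "\<lambda>r. r ^ CARD('n) / CARD('n)"])
       (use DERIV_cdivide[OF DERIV_pow[of "CARD('n)"], where c = "real CARD('n)"] in \<open>auto simp: card simp del: of_nat_add of_nat_Suc power_Suc\<close>)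
  also have "\<dots> = ennreal (1 / CARD('n))" by (simp add: card)
  finally have 2: "emeasure lborel (\<Phi> ` S) =
     ennreal (1 / CARD('n)) * (\<integral>\<^sup>+u. ennreal (indicator V u * W u) \<partial>lborel)" using 1 by simp
  have "emeasure spherical_measure (\<phi> ` V) =
     of_nat CARD('n) * ennreal (1 / CARD('n)) * (\<integral>\<^sup>+u. ennreal (indicator V u * W u) \<partial>lborel)"
    using V by (subst emeasure_spherical_measure) (simp_all add: cone 2 mult.assoc)
  also have "of_nat CARD('n) * ennreal (1 / CARD('n)) = 1"
    by (simp add: ennreal_of_nat_eq_real_of_nat flip: ennreal_mult)
  finally show ?thesis
    by (simp add: W_def) (intro nn_integral_cong, auto split: split_indicator)
qed

end

theory Submission
  imports Defs "HOL-Complex_Analysis.Complex_Analysis"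
begin

text \<open>
  The weight \<open>\<Prod>\<^sub>j \<bar>l\<^sub>j\<bar>\<^bsup>-\<lambda>\<^sub>j\<^esup>\<close> is homogeneous of degree \<open>-n\<close>, so its integral over a cone,
  cut off by \<open>1 \<le> \<rho> \<le> e\<close>, does not depend on the positive degree-one homogeneous function \<open>\<rho>\<close>.
  The choice \<open>\<rho> = norm\<close> gives the chamber periods; we use \<open>\<rho> = \<bar>h\<bar>\<close> for a linear form \<open>h\<close>
  vanishing at a point \<open>c\<close> of the chamber \<open>C\<close>.  Up to the phases \<open>V(a)\<^bsub>C,D\<^esub>\<close>, the weight is the
  boundary value of \<open>\<Prod>\<^sub>j (\<sigma>\<^sub>j l\<^sub>j - i0)\<^bsup>-\<lambda>\<^sub>j\<^esup>\<close>, where \<open>\<sigma>\<^sub>j\<close> is the sign of \<open>l\<^sub>j\<close> on \<open>C\<close>.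
  On each line parallel to \<open>c\<close> this is the boundary value of a function holomorphic in a half-plane
  that decays like \<open>\<bar>z\<bar>\<^bsup>-n\<^esup>\<close> with \<open>n \<ge> 2\<close>, so its integral vanishes; as \<open>h\<close> is constant on these lines,
  Fubini's theorem gives \<open>V(a) P = 0\<close>.

  Finiteness is local integrability away from the origin.  Near a point only the forms vanishing
  there matter, and their weight is at most a sum of products \<open>\<Prod>\<^bsub>v\<in>B\<^esub> \<bar>v \<bullet> x\<bar>\<^bsup>-\<theta>\<^esup>\<close> over linearly
  independent sets \<open>B\<close> with a common \<open>\<theta> < 1\<close>, by a greedy choice of basis.
\<close>

section \<open>Scaling and line integrals\<close>

lemma nn_integral_lborel_scaleR:
  fixes f :: "'a::euclidean_space \<Rightarrow> ennreal"
  assumes [measurable]: "f \<in> borel_measurable borel" and "c > 0"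
  shows "(\<integral>\<^sup>+x. f x \<partial>lborel) = (\<integral>\<^sup>+x. ennreal (c ^ DIM('a)) * f (c *\<^sub>R x) \<partial>lborel)"
proof -
  have "(\<integral>\<^sup>+x. f x \<partial>lborel) =
      (\<integral>\<^sup>+x. f x \<partial>density (distr lborel borel (\<lambda>x. 0 + c *\<^sub>R x)) (\<lambda>_. \<bar>c\<bar>^DIM('a)))"
    using lborel_affine[of c "0::'a"] \<open>c > 0\<close> by simp
  also have "\<dots> = (\<integral>\<^sup>+x. ennreal (c ^ DIM('a)) * f (c *\<^sub>R x) \<partial>lborel)"
    using \<open>c > 0\<close> by (simp add: nn_integral_density nn_integral_distr)
  finally show ?thesis .
qed

lemma nn_integral_lborel_translate:
  fixes f :: "'a::euclidean_space \<Rightarrow> ennreal"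
  assumes [measurable]: "f \<in> borel_measurable borel"
  shows "(\<integral>\<^sup>+x. f (x + c) \<partial>lborel) = (\<integral>\<^sup>+x. f x \<partial>lborel)"
proof -
  have "(\<integral>\<^sup>+x. f x \<partial>lborel) = (\<integral>\<^sup>+x. f x \<partial>distr lborel borel ((+) c))"
    by (simp add: lborel_distr_plus)
  also have "\<dots> = (\<integral>\<^sup>+x. f (x + c) \<partial>lborel)"
    by (simp add: nn_integral_distr add.commute)
  finally show ?thesis by simp
qed

lemma integral_lborel_translate:
  fixes f :: "'a::euclidean_space \<Rightarrow> 'b::{banach,second_countable_topology}"
  assumes [measurable]: "f \<in> borel_measurable borel"
  shows "(\<integral>x. f (x + c) \<partial>lborel) = (\<integral>x. f x \<partial>lborel)"
proof -
  have "(\<integral>x. f x \<partial>lborel) = (\<integral>x. f x \<partial>distr lborel borel ((+) c))"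
    by (simp add: lborel_distr_plus)
  also have "\<dots> = (\<integral>x. f (x + c) \<partial>lborel)"
    by (simp add: integral_distr add.commute)
  finally show ?thesis by simp
qed

text \<open>Both sides are the integral of \<open>\<psi> (\<rho>1 x) \<eta> (e\<^sup>s \<rho>2 x) f x\<close> over \<open>x\<close> and \<open>s\<close>, by the
  substitution \<open>x \<mapsto> e\<^sup>s x\<close>.\<close>

lemma nn_integral_homogeneous_swap:
  fixes f :: "'a::euclidean_space \<Rightarrow> ennreal" and \<rho>1 \<rho>2 :: "'a \<Rightarrow> real" and \<psi> \<eta> :: "real \<Rightarrow> ennreal"
  assumes f [measurable]: "f \<in> borel_measurable borel"
    and [measurable]: "\<psi> \<in> borel_measurable borel" "\<eta> \<in> borel_measurable borel"
    and [measurable]: "\<rho>1 \<in> borel_measurable borel" "\<rho>2 \<in> borel_measurable borel"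
    and homf: "\<And>t x. t > 0 \<Longrightarrow> ennreal (t ^ DIM('a)) * f (t *\<^sub>R x) = f x"
    and hom1: "\<And>t x. t > 0 \<Longrightarrow> \<rho>1 (t *\<^sub>R x) = t * \<rho>1 x"
    and hom2: "\<And>t x. t > 0 \<Longrightarrow> \<rho>2 (t *\<^sub>R x) = t * \<rho>2 x"
    and pos1: "AE x in lborel. \<rho>1 x > 0" and pos2: "AE x in lborel. \<rho>2 x > 0"
  shows "(\<integral>\<^sup>+x. \<psi> (\<rho>1 x) * f x \<partial>lborel) * (\<integral>\<^sup>+s. \<eta> (exp s) \<partial>lborel) =
         (\<integral>\<^sup>+x. \<eta> (\<rho>2 x) * f x \<partial>lborel) * (\<integral>\<^sup>+s. \<psi> (exp s) \<partial>lborel)"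
proof -
  \<comment> \<open>Since \<open>r * exp s = exp (s + ln r)\<close>, this is translation invariance
    in \<open>s\<close>; the second form adds a reflection.\<close>
  have haar: "(\<integral>\<^sup>+s. g (r * exp s) \<partial>lborel) = (\<integral>\<^sup>+s. g (exp s) \<partial>lborel)"
    "(\<integral>\<^sup>+s. g (exp (- s) * r) \<partial>lborel) = (\<integral>\<^sup>+s. g (exp s) \<partial>lborel)"
    if [measurable]: "g \<in> borel_measurable borel" and "r > 0" for g :: "real \<Rightarrow> ennreal" and r
    using \<open>r > 0\<close> nn_integral_real_affine[of "\<lambda>s. g (exp s)" 1 "ln r"]
      nn_integral_real_affine[of "\<lambda>s. g (exp s)" "-1" "ln r"]
    by (simp_all add: exp_add exp_diff exp_minus field_simps)
  have "(\<integral>\<^sup>+x. \<psi> (\<rho>1 x) * f x \<partial>lborel) * (\<integral>\<^sup>+s. \<eta> (exp s) \<partial>lborel) =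
      (\<integral>\<^sup>+x. \<psi> (\<rho>1 x) * f x * (\<integral>\<^sup>+s. \<eta> (exp s) \<partial>lborel) \<partial>lborel)"
    by (simp add: nn_integral_multc)
  \<comment> \<open>\<open>haar\<close> read backwards: the factor \<open>\<rho>2 x\<close>,
    positive almost everywhere, is absorbed into \<open>exp s\<close>.\<close>
  also have "\<dots> = (\<integral>\<^sup>+x. (\<integral>\<^sup>+s. \<psi> (\<rho>1 x) * f x * \<eta> (\<rho>2 x * exp s) \<partial>lborel) \<partial>lborel)"
    using pos2 by (intro nn_integral_cong_AE) (auto simp: nn_integral_cmult haar)
  also have "\<dots> = (\<integral>\<^sup>+s. (\<integral>\<^sup>+x. \<psi> (\<rho>1 x) * f x * \<eta> (\<rho>2 x * exp s) \<partial>lborel) \<partial>lborel)"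
    by (rule lborel_pair.Fubini'[symmetric]) measurable
  \<comment> \<open>Dilation by \<open>exp s\<close> relates the two inner integrals: its Jacobian
    cancels against the degree of \<open>f\<close>, and the scale moves, inverted, from the argument
    of \<eta> to that of \<psi>.\<close>
  also have "\<dots> = (\<integral>\<^sup>+s. (\<integral>\<^sup>+x. \<psi> (exp (- s) * \<rho>1 x) * f x * \<eta> (\<rho>2 x) \<partial>lborel) \<partial>lborel)"
  proof (rule nn_integral_cong)
    fix s :: real
    have "(\<integral>\<^sup>+x. \<psi> (exp (- s) * \<rho>1 x) * f x * \<eta> (\<rho>2 x) \<partial>lborel) =
       (\<integral>\<^sup>+x. ennreal (exp s ^ DIM('a)) * (\<psi> (exp (- s) * \<rho>1 (exp s *\<^sub>R x)) * f (exp s *\<^sub>R x) * \<eta> (\<rho>2 (exp s *\<^sub>R x))) \<partial>lborel)"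
      by (rule nn_integral_lborel_scaleR) auto
    also have "\<dots> = (\<integral>\<^sup>+x. \<psi> (\<rho>1 x) * f x * \<eta> (\<rho>2 x * exp s) \<partial>lborel)"
    proof (rule nn_integral_cong)
      fix x :: 'a
      have 1: "exp (- s) * \<rho>1 (exp s *\<^sub>R x) = \<rho>1 x" by (simp add: hom1 exp_minus)
      have 2: "\<rho>2 (exp s *\<^sub>R x) = \<rho>2 x * exp s" by (simp add: hom2)
      have "ennreal (exp s ^ DIM('a)) * (\<psi> (\<rho>1 x) * f (exp s *\<^sub>R x) * \<eta> (\<rho>2 x * exp s))
          = \<psi> (\<rho>1 x) * (ennreal (exp s ^ DIM('a)) * f (exp s *\<^sub>R x)) * \<eta> (\<rho>2 x * exp s)"
        by (simp only: mult_ac)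
      then show "ennreal (exp s ^ DIM('a)) * (\<psi> (exp (- s) * \<rho>1 (exp s *\<^sub>R x)) * f (exp s *\<^sub>R x) * \<eta> (\<rho>2 (exp s *\<^sub>R x)))
          = \<psi> (\<rho>1 x) * f x * \<eta> (\<rho>2 x * exp s)"
        by (simp only: 1 2 homf[OF exp_gt_zero])
    qed
    finally show "(\<integral>\<^sup>+x. \<psi> (\<rho>1 x) * f x * \<eta> (\<rho>2 x * exp s) \<partial>lborel) =
        (\<integral>\<^sup>+x. \<psi> (exp (- s) * \<rho>1 x) * f x * \<eta> (\<rho>2 x) \<partial>lborel)" ..
  qed
  also have "\<dots> = (\<integral>\<^sup>+x. (\<integral>\<^sup>+s. \<psi> (exp (- s) * \<rho>1 x) * f x * \<eta> (\<rho>2 x) \<partial>lborel) \<partial>lborel)"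
    by (rule lborel_pair.Fubini') measurable
  also have "\<dots> = (\<integral>\<^sup>+x. \<eta> (\<rho>2 x) * f x * (\<integral>\<^sup>+s. \<psi> (exp s) \<partial>lborel) \<partial>lborel)"
  proof (rule nn_integral_cong_AE)
    show "AE x in lborel. (\<integral>\<^sup>+s. \<psi> (exp (- s) * \<rho>1 x) * f x * \<eta> (\<rho>2 x) \<partial>lborel) =
        \<eta> (\<rho>2 x) * f x * (\<integral>\<^sup>+s. \<psi> (exp s) \<partial>lborel)"
      using pos1
    proof eventually_elim
      case (elim x)
      then have "(\<integral>\<^sup>+s. \<psi> (exp (- s) * \<rho>1 x) * f x * \<eta> (\<rho>2 x) \<partial>lborel) =
          (\<integral>\<^sup>+s. \<psi> (exp s) \<partial>lborel) * f x * \<eta> (\<rho>2 x)"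
        by (simp add: nn_integral_multc haar)
      then show ?case by (simp only: mult_ac)
    qed
  qed
  also have "\<dots> = (\<integral>\<^sup>+x. \<eta> (\<rho>2 x) * f x \<partial>lborel) * (\<integral>\<^sup>+s. \<psi> (exp s) \<partial>lborel)"
    by (simp add: nn_integral_multc)
  finally show ?thesis .
qed

text \<open>Fubini along the lines parallel to \<open>c\<close>, without adapted coordinates: insert
  a weight \<open>\<phi> (k \<bullet> x - s)\<close> of total mass one in \<open>s\<close>, then
  replace \<open>x\<close> by \<open>y + s *\<^sub>R c\<close>. As \<open>k \<bullet> c = 1\<close>,
  the weight becomes \<open>\<phi> (k \<bullet> y)\<close>, which no longer involves
  \<open>s\<close>, and a line integral of \<open>f\<close> remains inside.\<close>

lemma integral_zero_if_line_integrals_zero: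
  fixes f :: "'a::euclidean_space \<Rightarrow> complex" and c k :: 'a
  assumes f: "integrable lborel f" and kc: "k \<bullet> c = 1"
    and line: "\<And>y. integrable lborel (\<lambda>s. f (y + s *\<^sub>R c)) \<Longrightarrow> (\<integral>s. f (y + s *\<^sub>R c) \<partial>lborel) = 0"
  shows "(\<integral>x. f x \<partial>lborel) = 0"
proof -
  have [measurable]: "f \<in> borel_measurable borel" using f by auto
  define \<phi> :: "real \<Rightarrow> real" where "\<phi> = indicator {0..1}"
  have [measurable]: "\<phi> \<in> borel_measurable borel" unfolding \<phi>_def by measurable
  have \<phi>n: "(\<integral>\<^sup>+s. ennreal (\<phi> (a - s)) \<partial>lborel) = 1" for a
  proof -
    have "(\<integral>\<^sup>+s. ennreal (\<phi> (a - s)) \<partial>lborel) = (\<integral>\<^sup>+s. indicator {a-1..a} s \<partial>lborel)"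
      by (intro nn_integral_cong) (auto simp: \<phi>_def split: split_indicator)
    then show ?thesis by simp
  qed
  have \<phi>i: "(\<integral>s. \<phi> (a - s) \<partial>lborel) = 1" for a
    using \<phi>n[of a] by (subst integral_eq_nn_integral) (auto simp: \<phi>_def)
  have fin: "(\<integral>\<^sup>+x. ennreal (norm (f x)) \<partial>lborel) < \<infinity>"
    using f by (simp add: integrable_iff_bounded)
  have tr: "(\<integral>\<^sup>+y. ennreal (norm (f (y + s *\<^sub>R c))) * ennreal (\<phi> (k \<bullet> y)) \<partial>lborel) =
      (\<integral>\<^sup>+x. ennreal (norm (f x)) * ennreal (\<phi> (k \<bullet> x - s)) \<partial>lborel)" for s
  proof -
    have "(\<integral>\<^sup>+x. ennreal (norm (f x)) * ennreal (\<phi> (k \<bullet> x - s)) \<partial>lborel) =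
      (\<integral>\<^sup>+y. ennreal (norm (f (y + s *\<^sub>R c))) * ennreal (\<phi> (k \<bullet> (y + s *\<^sub>R c) - s)) \<partial>lborel)"
      by (rule nn_integral_lborel_translate[symmetric]) measurable
    then show ?thesis by (simp add: inner_add_right kc)
  qed
  \<comment> \<open>Tonelli for the norms; by \<open>tr\<close> the same bound serves before and
    after the translation, so Fubini applies on both sides.\<close>
  have fub: "(\<integral>\<^sup>+s. (\<integral>\<^sup>+x. ennreal (norm (f x)) * ennreal (\<phi> (k \<bullet> x - s)) \<partial>lborel) \<partial>lborel) < \<infinity>"
  proof -
    have "(\<integral>\<^sup>+s. (\<integral>\<^sup>+x. ennreal (norm (f x)) * ennreal (\<phi> (k \<bullet> x - s)) \<partial>lborel) \<partial>lborel) =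
      (\<integral>\<^sup>+x. (\<integral>\<^sup>+s. ennreal (norm (f x)) * ennreal (\<phi> (k \<bullet> x - s)) \<partial>lborel) \<partial>lborel)"
      by (rule lborel_pair.Fubini') measurable
    also have "\<dots> = (\<integral>\<^sup>+x. ennreal (norm (f x)) \<partial>lborel)"
      by (simp add: nn_integral_cmult \<phi>n)
    finally show ?thesis using fin by simp
  qed
  have nrm: "norm (z * of_real (\<phi> r)) = norm z * \<phi> r" for z :: complex and r
    by (simp add: norm_mult \<phi>_def)
  have phi0: "0 \<le> \<phi> r" for r by (simp add: \<phi>_def)
  have int1: "integrable (lborel \<Otimes>\<^sub>M lborel) (\<lambda>(x, s). f x * of_real (\<phi> (k \<bullet> x - s)))"
  proof (rule integrableI_bounded)
    have "(\<integral>\<^sup>+p. ennreal (norm ((\<lambda>(x, s). f x * of_real (\<phi> (k \<bullet> x - s))) p)) \<partial>(lborel \<Otimes>\<^sub>M lborel)) =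
      (\<integral>\<^sup>+s. (\<integral>\<^sup>+x. ennreal (norm (f x)) * ennreal (\<phi> (k \<bullet> x - s)) \<partial>lborel) \<partial>lborel)"
      by (subst lborel_pair.nn_integral_snd[symmetric]) (auto simp: nrm ennreal_mult phi0)
    with fub show "(\<integral>\<^sup>+p. ennreal (norm ((\<lambda>(x, s). f x * of_real (\<phi> (k \<bullet> x - s))) p)) \<partial>(lborel \<Otimes>\<^sub>M lborel)) < \<infinity>"
      by simp
  qed measurable
  have int2: "integrable (lborel \<Otimes>\<^sub>M lborel) (\<lambda>(y, s). f (y + s *\<^sub>R c) * of_real (\<phi> (k \<bullet> y)))"
  proof (rule integrableI_bounded)
    have "(\<integral>\<^sup>+p. ennreal (norm ((\<lambda>(y, s). f (y + s *\<^sub>R c) * of_real (\<phi> (k \<bullet> y))) p)) \<partial>(lborel \<Otimes>\<^sub>M lborel)) =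
      (\<integral>\<^sup>+s. (\<integral>\<^sup>+y. ennreal (norm (f (y + s *\<^sub>R c))) * ennreal (\<phi> (k \<bullet> y)) \<partial>lborel) \<partial>lborel)"
      by (subst lborel_pair.nn_integral_snd[symmetric]) (auto simp: nrm ennreal_mult phi0)
    with fub show "(\<integral>\<^sup>+p. ennreal (norm ((\<lambda>(y, s). f (y + s *\<^sub>R c) * of_real (\<phi> (k \<bullet> y))) p)) \<partial>(lborel \<Otimes>\<^sub>M lborel)) < \<infinity>"
      by (simp add: tr)
  qed measurable
  have "(\<integral>x. f x \<partial>lborel) = (\<integral>x. (\<integral>s. f x * of_real (\<phi> (k \<bullet> x - s)) \<partial>lborel) \<partial>lborel)"
    by (simp add: \<phi>i)
  also have "\<dots> = (\<integral>s. (\<integral>x. f x * of_real (\<phi> (k \<bullet> x - s)) \<partial>lborel) \<partial>lborel)"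
    by (rule lborel_pair.Fubini_integral[OF int1, symmetric])
  also have "\<dots> = (\<integral>s. (\<integral>y. f (y + s *\<^sub>R c) * of_real (\<phi> (k \<bullet> y)) \<partial>lborel) \<partial>lborel)"
  proof (rule Bochner_Integration.integral_cong[OF refl])
    fix s
    have "(\<integral>x. f x * of_real (\<phi> (k \<bullet> x - s)) \<partial>lborel) =
       (\<integral>y. f (y + s *\<^sub>R c) * of_real (\<phi> (k \<bullet> (y + s *\<^sub>R c) - s)) \<partial>lborel)"
      by (rule integral_lborel_translate[symmetric]) measurable
    then show "(\<integral>x. f x * of_real (\<phi> (k \<bullet> x - s)) \<partial>lborel) =
      (\<integral>y. f (y + s *\<^sub>R c) * of_real (\<phi> (k \<bullet> y)) \<partial>lborel)" by (simp add: inner_add_right kc)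
  qed
  also have "\<dots> = (\<integral>y. (\<integral>s. f (y + s *\<^sub>R c) * of_real (\<phi> (k \<bullet> y)) \<partial>lborel) \<partial>lborel)"
    by (rule lborel_pair.Fubini_integral[OF int2])
  also have "\<dots> = (\<integral>(y::'a). 0 \<partial>lborel)"
  proof (rule integral_cong_AE)
    show "AE y in lborel. (\<integral>s. f (y + s *\<^sub>R c) * of_real (\<phi> (k \<bullet> y)) \<partial>lborel) = 0"
      using lborel_pair.AE_integrable_fst'[OF int2]
    proof eventually_elim
      case (elim y)
      show ?case
      \<comment> \<open>\<phi> takes only the values 0 and 1. Where it is 1, the almost everywhere
        integrability from Fubini is that of \<open>f\<close> on the line, as \<open>line\<close>
        requires.\<close>
      proof (cases "\<phi> (k \<bullet> y) = 0")
        case False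
        then have "\<phi> (k \<bullet> y) = 1" by (simp add: \<phi>_def indicator_def split: if_splits)
        with elim line[of y] show ?thesis by simp
      qed simp
    qed
  qed auto
  finally show ?thesis by simp
qed

section \<open>Boundary values of powers from a half-plane\<close>

text \<open>Rotating the argument of \<open>Ln\<close> moves the branch cut to the positive imaginary axis, so that the
  power is continuous on the closed lower half-plane without the origin.\<close>

definition lower_powr :: "complex \<Rightarrow> real \<Rightarrow> complex" where
  "lower_powr w r = exp (of_real r * (Ln (\<i> * w) - \<i> * of_real pi / 2))"

lemma norm_lower_powr:
  assumes "w \<noteq> 0"
  shows "norm (lower_powr w r) = norm w powr r"
  using assms by (simp add: lower_powr_def powr_def norm_mult)

lemma lower_powr_of_real_pos:
  assumes "t > 0"
  shows "lower_powr (of_real t) r = of_real (t powr r)"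
proof -
  have "Ln (\<i> * of_real t) = of_real (ln t) + \<i> * of_real pi / 2"
    using assms Ln_times_of_real[of t \<i>] by (simp add: mult.commute Ln_of_real)
  then show ?thesis using assms by (simp add: lower_powr_def powr_def exp_of_real flip: of_real_mult)
qed

text \<open>On the closed lower half-plane without the origin the chosen argument runs from 0 down
  to \<open>-pi\<close>, its value on the negative axis. For \<open>r = - lam j\<close> the factor
  is \<open>exp (pi * \<i> * lam j)\<close>, the phase in the matrix.\<close>

lemma lower_powr_of_real_neg:
  assumes "t < 0"
  shows "lower_powr (of_real t) r = exp (- (of_real pi * \<i> * of_real r)) * of_real (\<bar>t\<bar> powr r)"
proof -
  have "Ln (\<i> * of_real t) = of_real (ln (-t)) - \<i> * of_real pi / 2"
    using assms Ln_times_of_real[of "-t" "-\<i>"] Ln_of_real[of "-t"] by (simp add: mult.commute)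
  then have "lower_powr (of_real t) r = exp (- (of_real pi * \<i> * of_real r) + of_real (r * ln (-t)))"
    unfolding lower_powr_def by (simp only:) (rule arg_cong[where f = exp], simp add: field_simps)
  then show ?thesis using assms by (simp only: exp_add exp_of_real) (simp add: powr_def)
qed

lemma isCont_lower_powr:
  assumes "Im w \<le> 0" "w \<noteq> 0"
  shows "isCont (\<lambda>w. lower_powr w r) w"
proof -
  \<comment> \<open>A nonpositive real \<open>\<i> * w\<close> would put \<open>w\<close> on the
    closed positive imaginary axis, which meets the closed lower half-plane only at 0.\<close>
  have "\<i> * w \<notin> \<real>\<^sub>\<le>\<^sub>0"
    using assms by (auto simp: complex_nonpos_Reals_iff complex_eq_iff)
  then show ?thesis unfolding lower_powr_def by (intro continuous_intros) auto
qed

lemma holomorphic_on_lower_powr [holomorphic_intros]: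
  assumes "f holomorphic_on S" "\<And>z. z \<in> S \<Longrightarrow> Im (f z) < 0"
  shows "(\<lambda>z. lower_powr (f z) r) holomorphic_on S"
  unfolding lower_powr_def
proof (intro holomorphic_intros assms)
  fix z assume "z \<in> S"
  with assms(2)[of z] show "\<i> * f z \<notin> \<real>\<^sub>\<le>\<^sub>0" by (auto simp: complex_nonpos_Reals_iff)
qed

lemma measurable_lower_powr [measurable]:
  "(\<lambda>w. lower_powr w r) \<in> borel_measurable borel"
  unfolding lower_powr_def by measurable

lemma powr_sum:
  fixes x :: real
  assumes "x > 0" "finite A"
  shows "x powr sum f A = (\<Prod>i\<in>A. x powr f i)"
  using assms by (simp add: powr_def exp_sum[symmetric] sum_distrib_right)

text \<open>With a primitive \<Phi> on the half-plane, the integral over \<open>{-R..R}\<close> is a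
  difference of two values of \<Phi>. Each differs from the value at the apex
  \<open>Complex 0 (R + \<epsilon>)\<close> by at most segment length times decay, of order
  \<open>R powr (1 - \<sigma>)\<close>, which tends to 0.\<close>

lemma integral_horizontal_line_zero:
  fixes H :: "complex \<Rightarrow> complex"
  assumes holo: "H holomorphic_on {z. Im z > 0}" and \<epsilon>: "\<epsilon> > 0"
    and decay: "\<And>z. Im z > 0 \<Longrightarrow> norm z \<ge> R0 \<Longrightarrow> norm (H z) \<le> K * norm z powr (- \<sigma>)" and \<sigma>: "\<sigma> > 1"
    and int: "integrable lborel (\<lambda>s. H (Complex s \<epsilon>))"
  shows "(\<integral>s. H (Complex s \<epsilon>) \<partial>lborel) = 0"
proof -
  have cvx: "convex {z. Im z > 0}" by (simp add: convex_halfspace_Im_gt)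
  have opn: "open {z. Im z > 0}" by (simp add: open_halfspace_Im_gt)
  obtain \<Phi> where \<Phi>: "\<And>z. Im z > 0 \<Longrightarrow> (\<Phi> has_field_derivative H z) (at z)"
    using holomorphic_convex_primitive'[OF cvx opn holo] at_within_open[OF _ opn] by fastforce
  let ?I = "\<lambda>R. (\<integral>s. indicator {-R..R} s *\<^sub>R H (Complex s \<epsilon>) \<partial>lborel)"
  have FTC: "?I R = \<Phi> (Complex R \<epsilon>) - \<Phi> (Complex (-R) \<epsilon>)" if "R > 0" for R
  proof -
    have lin: "((\<lambda>s. Complex s \<epsilon>) has_vector_derivative 1) (at s within A)" for s A
      by (auto simp: Complex_eq intro!: derivative_eq_intros)
    have "((\<lambda>s. H (Complex s \<epsilon>)) has_integral (\<Phi> (Complex R \<epsilon>) - \<Phi> (Complex (-R) \<epsilon>))) {-R..R}"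
    proof (rule fundamental_theorem_of_calculus)
      fix s assume "s \<in> {-R..R}"
      have "((\<Phi> \<circ> (\<lambda>s. Complex s \<epsilon>)) has_vector_derivative (1 * H (Complex s \<epsilon>))) (at s within {-R..R})"
        using lin \<epsilon> by (intro field_vector_diff_chain_within[OF lin])
           (auto intro!: has_field_derivative_at_within \<Phi>)
      then show "((\<lambda>s. \<Phi> (Complex s \<epsilon>)) has_vector_derivative H (Complex s \<epsilon>)) (at s within {-R..R})"
        by (simp add: o_def)
    qed (use that in auto)
    moreover have "set_integrable lborel {-R..R} (\<lambda>s. H (Complex s \<epsilon>))"
      unfolding set_integrable_def using int by (intro integrable_mult_indicator) auto
    ultimately show ?thesis
      using set_borel_integral_eq_integral(2)[of "{-R..R}" "\<lambda>s. H (Complex s \<epsilon>)"]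
      by (simp add: set_lebesgue_integral_def integral_unique)
  qed
  \<comment> \<open>Two segments of length at most \<open>2 * R\<close>, on which
    \<open>norm z\<close> is at least \<open>R / 2\<close>, give the constant;
    \<open>R \<ge> 2 * \<bar>R0\<bar>\<close> puts them in the range of
    \<open>decay\<close>.\<close>
  have bound: "norm (?I R) \<le> (4 * \<bar>K\<bar> * 2 powr \<sigma>) * R powr (1 - \<sigma>)" if R: "R \<ge> max 1 (2 * \<bar>R0\<bar>)" for R
  proof -
    have R0: "R > 0" "R / 2 \<ge> R0" using R by auto
    have seg: "norm (\<Phi> (Complex r \<epsilon>) - \<Phi> (Complex 0 (R + \<epsilon>))) \<le>
        (\<bar>K\<bar> * (R / 2) powr (- \<sigma>)) * norm (Complex r \<epsilon> - Complex 0 (R + \<epsilon>))" if r: "\<bar>r\<bar> = R" for r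
    proof (rule field_differentiable_bound[where S = "closed_segment (Complex r \<epsilon>) (Complex 0 (R + \<epsilon>))"])
      fix z assume "z \<in> closed_segment (Complex r \<epsilon>) (Complex 0 (R + \<epsilon>))"
      then obtain t where t: "0 \<le> t" "t \<le> 1"
          "z = (1 - t) *\<^sub>R Complex r \<epsilon> + t *\<^sub>R Complex 0 (R + \<epsilon>)"
        by (auto simp: in_segment)
      have Imz: "Im z = \<epsilon> + t * R" and Rez: "Re z = (1 - t) * r"
        unfolding t(3) by (simp_all add: algebra_simps)
      have Impos: "Im z > 0" using \<epsilon> t R0 unfolding Imz by (simp add: add_pos_nonneg)
      \<comment> \<open>Along the segment \<open>\<bar>Re z\<bar>\<close> falls from
        \<open>R\<close> while \<open>Im z\<close> rises, and their sum stays at least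
        \<open>R\<close>; so one of them is at least \<open>R / 2\<close>.\<close>
      have "(1 - t) * R = \<bar>Re z\<bar>" using t(1,2) r by (simp add: Rez abs_mult)
      moreover have "t * R \<le> \<bar>Im z\<bar>" using \<epsilon> t(1,2) R0 by (simp add: Imz)
      ultimately have "R \<le> \<bar>Re z\<bar> + \<bar>Im z\<bar>" by (simp add: algebra_simps)
      then have big: "R / 2 \<le> norm z" using abs_Re_le_cmod[of z] abs_Im_le_cmod[of z] by linarith
      have "norm (H z) \<le> K * norm z powr (- \<sigma>)" using decay[OF Impos] big R0 by linarith
      also have "\<dots> \<le> \<bar>K\<bar> * norm z powr (- \<sigma>)" by (intro mult_right_mono) auto
      also have "\<dots> \<le> \<bar>K\<bar> * (R / 2) powr (- \<sigma>)"
        using big R0 \<sigma> by (intro mult_left_mono powr_mono2') auto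
      finally show "norm (H z) \<le> \<bar>K\<bar> * (R / 2) powr (- \<sigma>)" .
      show "(\<Phi> has_field_derivative H z) (at z within closed_segment (Complex r \<epsilon>) (Complex 0 (R + \<epsilon>)))"
        using \<Phi>[OF Impos] by (rule has_field_derivative_at_within)
    qed auto
    have len: "norm (Complex r \<epsilon> - Complex 0 (R + \<epsilon>)) \<le> 2 * R" if r: "\<bar>r\<bar> = R" for r
      using cmod_le[of "Complex r \<epsilon> - Complex 0 (R + \<epsilon>)"] r R0 by simp
    have "norm (\<Phi> (Complex r \<epsilon>) - \<Phi> (Complex 0 (R + \<epsilon>))) \<le> (\<bar>K\<bar> * (R / 2) powr (- \<sigma>)) * (2 * R)" if r: "\<bar>r\<bar> = R" for r
      using seg[OF r] len[OF r] by (rule order_trans[OF _ mult_left_mono]) simp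
    from this[of R] this[of "-R"] have "norm (?I R) \<le> 2 * ((\<bar>K\<bar> * (R / 2) powr (- \<sigma>)) * (2 * R))"
      unfolding FTC[OF R0(1)] using R0
        norm_triangle_ineq4[of "\<Phi> (Complex R \<epsilon>) - \<Phi> (Complex 0 (R + \<epsilon>))" "\<Phi> (Complex (-R) \<epsilon>) - \<Phi> (Complex 0 (R + \<epsilon>))"]
      by simp
    also have "\<dots> = (4 * \<bar>K\<bar> * 2 powr \<sigma>) * R powr (1 - \<sigma>)"
      using R0 by (simp add: powr_divide powr_minus powr_diff field_simps)
    finally show ?thesis .
  qed
  have "((\<lambda>R. (4 * \<bar>K\<bar> * 2 powr \<sigma>) * R powr (1 - \<sigma>)) \<longlongrightarrow> 0) at_top"
    using \<sigma> by (intro tendsto_mult_right_zero tendsto_neg_powr filterlim_ident) auto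
  then have lim0: "(?I \<longlongrightarrow> 0) at_top"
    by (rule Lim_null_comparison[rotated]) (unfold eventually_at_top_linorder, use bound in blast)
  have "(\<lambda>n. ?I (real n)) \<longlonglongrightarrow> (\<integral>s. H (Complex s \<epsilon>) \<partial>lborel)"
  proof (rule integral_dominated_convergence)
    show "integrable lborel (\<lambda>s. norm (H (Complex s \<epsilon>)))" using int by simp
    show "AE s in lborel. (\<lambda>n. indicator {-real n..real n} s *\<^sub>R H (Complex s \<epsilon>)) \<longlonglongrightarrow> H (Complex s \<epsilon>)"
    proof (intro AE_I2 tendsto_eventually)
      fix s :: real
      show "\<forall>\<^sub>F n in sequentially. indicator {-real n..real n} s *\<^sub>R H (Complex s \<epsilon>) = H (Complex s \<epsilon>)"
        using eventually_ge_at_top[of "nat \<lceil>\<bar>s\<bar>\<rceil>"]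
      proof eventually_elim
        case (elim n)
        then have "\<bar>s\<bar> \<le> real n" by linarith
        then show ?case by (simp add: indicator_def abs_le_iff)
      qed
    qed
  qed (use int in \<open>auto split: split_indicator\<close>)
  moreover have "(\<lambda>n. ?I (real n)) \<longlonglongrightarrow> 0"
    using filterlim_compose[OF lim0 filterlim_real_sequentially] by simp
  ultimately show ?thesis by (rule LIMSEQ_unique)
qed

text \<open>As \<open>c j > 0\<close>, each \<open>b j - z * c j\<close> lies in the open lower
  half-plane when \<open>Im z > 0\<close>, so the product extends holomorphically above the real
  line. Its integral vanishes at every height \<open>e > 0\<close>, and dominated convergence lets
  \<open>e\<close> tend to 0.\<close>

lemma integral_line_prod_lower_powr_zero:
  fixes b c lam :: "'i \<Rightarrow> real"
  assumes fin: "finite J" and c: "\<And>j. j \<in> J \<Longrightarrow> c j > 0" and lam: "\<And>j. j \<in> J \<Longrightarrow> lam j > 0"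
    and sum: "(\<Sum>j\<in>J. lam j) > 1"
    and int: "integrable lborel (\<lambda>s::real. \<Prod>j\<in>J. lower_powr (of_real (b j - s * c j)) (- lam j))"
  shows "(\<integral>s. (\<Prod>j\<in>J. lower_powr (of_real (b j - s * c j)) (- lam j)) \<partial>lborel) = 0"
proof -
  define H where "H = (\<lambda>z. \<Prod>j\<in>J. lower_powr (of_real (b j) - z * of_real (c j)) (- lam j))"
  define G where "G = (\<lambda>s::real. H (of_real s))"
  have Geq: "(\<lambda>s::real. \<Prod>j\<in>J. lower_powr (of_real (b j - s * c j)) (- lam j)) = G"
    by (simp add: G_def H_def)
  have holo: "H holomorphic_on {z. Im z > 0}"
    unfolding H_def by (intro holomorphic_intros) (use c in auto)
  have [measurable]: "H \<in> borel_measurable borel"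
    unfolding H_def by measurable
  have [measurable]: "(\<lambda>s. Complex s e) \<in> borel_measurable borel" for e
    by (intro borel_measurable_continuous_onI) (auto simp: Complex_eq intro!: continuous_intros)
  \<comment> \<open>The finitely many real singularities; domination and convergence are claimed off
    this null set only.\<close>
  define N where "N = (\<Union>j\<in>J. {b j / c j})"
  have N: "finite N" using fin by (auto simp: N_def)
  have AEN: "AE s in lborel. s \<notin> N"
    using N by (intro AE_not_in) (auto simp: finite_imp_null_set_lborel)
  have ne: "of_real (b j) - z * of_real (c j) \<noteq> 0" if "Im z > 0" "j \<in> J" for z j
    using that c[of j] by (auto dest!: arg_cong[where f = Im])
  have off: "b j - s * c j \<noteq> 0" if "s \<notin> N" "j \<in> J" for s j
    using that c[of j] by (auto simp: N_def field_simps)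
  \<comment> \<open>Moving off the real axis only increases each \<open>\<bar>b j - s c j\<bar>\<close>: the boundary function dominates.\<close>
  have Hle: "norm (H (Complex s e)) \<le> norm (G s)" if "s \<notin> N" "e > 0" for s e
  proof -
    have "norm (H (Complex s e)) = (\<Prod>j\<in>J. norm (of_real (b j) - Complex s e * of_real (c j)) powr (- lam j))"
      unfolding H_def prod_norm[symmetric]
      using that by (intro prod.cong norm_lower_powr ne refl) auto
    also have "\<dots> \<le> (\<Prod>j\<in>J. norm (complex_of_real (b j - s * c j)) powr (- lam j))"
    proof (intro prod_mono conjI powr_mono2')
      fix j assume j: "j \<in> J"
      show "norm (complex_of_real (b j - s * c j)) > 0"
        using off[OF that(1) j] by (simp only: zero_less_norm_iff of_real_eq_0_iff not_False_eq_True)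
      have "norm (complex_of_real (b j - s * c j)) = \<bar>Re (of_real (b j) - Complex s e * of_real (c j))\<bar>"
        by (simp del: of_real_diff of_real_mult)
      also have "\<dots> \<le> norm (of_real (b j) - Complex s e * of_real (c j))" by (rule abs_Re_le_cmod)
      finally show "norm (complex_of_real (b j - s * c j)) \<le> norm (of_real (b j) - Complex s e * of_real (c j))" .
    qed (use lam in \<open>auto simp: less_imp_le\<close>)
    also have "\<dots> = norm (G s)"
      unfolding Geq[symmetric] prod_norm[symmetric]
      by (intro prod.cong norm_lower_powr[symmetric] refl)
        (simp only: of_real_eq_0_iff off[OF that(1)] not_False_eq_True)
    finally show ?thesis .
  qed
  have intG: "integrable lborel G" using int by (simp only: Geq)
  have intH: "integrable lborel (\<lambda>s. H (Complex s e))" if "e > 0" for e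
    using intG by (rule Bochner_Integration.integrable_bound)
       (use AEN Hle[OF _ that] in \<open>auto elim: eventually_mono\<close>)
  \<comment> \<open>Beyond \<open>R0\<close> one has
    \<open>\<bar>b j\<bar> \<le> c j / 2 * norm z\<close>, which leaves at least
    \<open>c j / 2 * norm z\<close> for the modulus of \<open>b j - z * c j\<close>. The entry 1
    keeps \<open>norm z\<close> positive.\<close>
  define R0 where "R0 = Max (insert 1 ((\<lambda>j. 2 * \<bar>b j\<bar> / c j) ` J))"
  have R0: "R0 \<ge> 1" "\<And>j. j \<in> J \<Longrightarrow> 2 * \<bar>b j\<bar> / c j \<le> R0"
    unfolding R0_def using fin by auto
  have decay: "norm (H z) \<le> (\<Prod>j\<in>J. (c j / 2) powr (- lam j)) * norm z powr (- (\<Sum>j\<in>J. lam j))"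
    if z: "Im z > 0" "norm z \<ge> R0" for z
  proof -
    have "norm (H z) = (\<Prod>j\<in>J. norm (of_real (b j) - z * of_real (c j)) powr (- lam j))"
      unfolding H_def prod_norm[symmetric]
      using z by (intro prod.cong norm_lower_powr ne refl) auto
    also have "\<dots> \<le> (\<Prod>j\<in>J. (c j / 2 * norm z) powr (- lam j))"
    proof (intro prod_mono conjI powr_mono2')
      fix j assume j: "j \<in> J"
      show "c j / 2 * norm z > 0" using c[OF j] R0(1) z(2) by (intro mult_pos_pos) linarith+
      have "2 * \<bar>b j\<bar> \<le> norm z * c j" using R0(2)[OF j] c[OF j] z(2) by (simp add: field_simps)
          (smt (verit) mult_right_mono)
      moreover have "norm (z * of_real (c j)) = norm z * c j" using c[OF j] by (simp add: norm_mult)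
      ultimately show "c j / 2 * norm z \<le> norm (of_real (b j) - z * of_real (c j))"
        using norm_triangle_ineq2[of "z * of_real (c j)" "of_real (b j)"]
        by (simp add: norm_minus_commute field_simps)
    qed (use lam in \<open>auto simp: less_imp_le\<close>)
    also have "\<dots> = (\<Prod>j\<in>J. (c j / 2) powr (- lam j) * norm z powr (- lam j))"
      using c by (intro prod.cong refl powr_mult)
    also have "\<dots> = (\<Prod>j\<in>J. (c j / 2) powr (- lam j)) * norm z powr (- (\<Sum>j\<in>J. lam j))"
      using powr_sum[OF less_le_trans[OF zero_less_one order_trans[OF R0(1) z(2)]] fin, of "\<lambda>j. - lam j"]
      by (simp add: prod.distrib sum_negf)
    finally show ?thesis .
  qed
  have zero: "(\<integral>s. H (Complex s e) \<partial>lborel) = 0" if "e > 0" for e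
    using integral_horizontal_line_zero[OF holo that decay sum intH[OF that]] .
  have "(\<lambda>n. \<integral>s. H (Complex s (1 / real (Suc n))) \<partial>lborel) \<longlonglongrightarrow> (\<integral>s. G s \<partial>lborel)"
  proof (rule integral_dominated_convergence)
    show "integrable lborel (\<lambda>s. norm (G s))" using intG by simp
    show "G \<in> borel_measurable lborel" using intG by simp
    show "AE s in lborel. norm (H (Complex s (1 / real (Suc n)))) \<le> norm (G s)" for n
      using AEN by eventually_elim (rule Hle, auto)
    show "AE s in lborel. (\<lambda>n. H (Complex s (1 / real (Suc n)))) \<longlonglongrightarrow> G s"
      using AEN
    proof eventually_elim
      fix s assume s: "s \<notin> N"
      have "isCont H (of_real s)"
        unfolding H_def
      proof (intro continuous_intros)
        fix j assume j: "j \<in> J"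
        have "isCont (\<lambda>w. lower_powr w (- lam j)) (of_real (b j) - of_real s * of_real (c j))"
          using off[OF s j] by (intro isCont_lower_powr) (auto simp: complex_eq_iff)
        then show "isCont (\<lambda>z. lower_powr (of_real (b j) - z * of_real (c j)) (- lam j)) (of_real s)"
          by (rule isCont_o2[where f = "\<lambda>z. of_real (b j) - z * of_real (c j)", rotated])
             (intro continuous_intros)
      qed
      moreover have "(\<lambda>n. Complex s (1 / real (Suc n))) \<longlonglongrightarrow> of_real s"
        unfolding complex_of_real_def by (intro tendsto_Complex tendsto_const lim_1_over_n[THEN LIMSEQ_Suc])
      ultimately show "(\<lambda>n. H (Complex s (1 / real (Suc n)))) \<longlonglongrightarrow> G s"
        unfolding G_def by (rule isCont_tendsto_compose)
    qed
  qed measurable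
  then show ?thesis
    unfolding Geq by (simp add: zero LIMSEQ_const_iff)
qed

section \<open>Local integrability of products of powers\<close>

text \<open>The point is uniformity in \<open>t\<close>: where \<open>\<bar>t + s\<bar> > 1\<close>
  the power is at most 1 on an interval of length one, and elsewhere it is a translate of the
  truncated power \<open>g\<close>, whose integral does not depend on the shift.\<close>

lemma nn_integral_shifted_powr_bounded:
  fixes \<theta> :: real
  assumes "0 < \<theta>" "\<theta> < 1"
  obtains K :: real where "\<And>t. (\<integral>\<^sup>+s. indicator {0..1} s * ennreal (\<bar>t + s\<bar> powr (- \<theta>)) \<partial>lborel) \<le> ennreal K"
proof
  define g where "g = (\<lambda>u::real. indicator {-1..1} u * \<bar>u\<bar> powr (- \<theta>))"
  have [measurable]: "g \<in> borel_measurable borel" unfolding g_def by measurable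
  have g0: "0 \<le> g u" for u by (simp add: g_def)
  have h: "((\<lambda>u. u powr (- \<theta>)) has_integral (1 / (1 - \<theta>))) {0..1}"
    using has_integral_powr_from_0[of "-\<theta>" 1] assms by simp
  have h1: "(g has_integral (1 / (1 - \<theta>))) {0..1}"
    using h by (rule has_integral_eq[rotated]) (auto simp: g_def)
  have "((\<lambda>u. g (- u)) has_integral (1 / (1 - \<theta>))) {-1..0}"
    using has_integral_reflect_real[of g _ 1 0] h1 by simp
  moreover have "(\<lambda>u. g (- u)) = g" by (auto simp: g_def indicator_def)
  ultimately have "(g has_integral (1 / (1 - \<theta>) + 1 / (1 - \<theta>))) {-1..1}"
    using h1 by (intro has_integral_combine[of "-1" 0 1 g]) auto
  then have "((\<lambda>x. if x \<in> {-1..1} then g x else 0) has_integral (1 / (1 - \<theta>) + 1 / (1 - \<theta>))) UNIV"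
    by (simp only: has_integral_restrict_UNIV)
  moreover have "(\<lambda>x. if x \<in> {-1..1} then g x else 0) = g" by (auto simp: g_def indicator_def)
  ultimately have gi: "(\<integral>\<^sup>+u. ennreal (g u) \<partial>lborel) = ennreal (1 / (1 - \<theta>) + 1 / (1 - \<theta>))"
    using g0 by (intro nn_integral_has_integral_lborel) auto
  fix t
  have "(\<integral>\<^sup>+s. indicator {0..1} s * ennreal (\<bar>t + s\<bar> powr (- \<theta>)) \<partial>lborel) \<le>
      (\<integral>\<^sup>+s. indicator {0..1} s + ennreal (g (s + t)) \<partial>lborel)"
  proof (rule nn_integral_mono)
    fix s :: real
    show "indicator {0..1} s * ennreal (\<bar>t + s\<bar> powr (- \<theta>)) \<le> indicator {0..1} s + ennreal (g (s + t))"
    proof (cases "\<bar>t + s\<bar> \<le> 1")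
      case True
      then have "g (s + t) = \<bar>t + s\<bar> powr (- \<theta>)" by (simp add: g_def add.commute abs_le_iff)
      then show ?thesis by (auto simp: indicator_def)
    next
      case False
      then have "\<bar>t + s\<bar> powr (- \<theta>) \<le> 1"
        using assms powr_mono2'[of "-\<theta>" 1 "\<bar>t + s\<bar>"] by simp
      then have "ennreal (\<bar>t + s\<bar> powr (- \<theta>)) \<le> 1" using ennreal_leI by fastforce
      then show ?thesis by (auto simp: indicator_def intro: add_increasing2)
    qed
  qed
  also have "\<dots> = 1 + (\<integral>\<^sup>+s. ennreal (g (s + t)) \<partial>lborel)"
    by (simp add: nn_integral_add)
  also have "(\<integral>\<^sup>+s. ennreal (g (s + t)) \<partial>lborel) = ennreal (1 / (1 - \<theta>) + 1 / (1 - \<theta>))"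
    using nn_integral_lborel_translate[of "\<lambda>u. ennreal (g u)" t] gi by simp
  also have "1 + ennreal (1 / (1 - \<theta>) + 1 / (1 - \<theta>)) = ennreal (1 + (1 / (1 - \<theta>) + 1 / (1 - \<theta>)))"
    using assms by (simp add: ennreal_plus)
  finally show "(\<integral>\<^sup>+s. indicator {0..1} s * ennreal (\<bar>t + s\<bar> powr (- \<theta>)) \<partial>lborel) \<le>
     ennreal (1 + (1 / (1 - \<theta>) + 1 / (1 - \<theta>)))" .
qed

text \<open>The component of \<open>b\<close> orthogonal to \<open>span B\<close>, normalised; it is
  nonzero because \<open>b \<notin> span B\<close>.\<close>

lemma exists_dual_vector:
  fixes b :: "'a::euclidean_space"
  assumes "b \<notin> span B"
  obtains w where "b \<bullet> w = 1" "\<And>x. x \<in> B \<Longrightarrow> x \<bullet> w = 0"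
proof -
  obtain y z where yz: "y \<in> span B" "\<And>w. w \<in> span B \<Longrightarrow> orthogonal z w" "b = y + z"
    using orthogonal_subspace_decomp_exists[of B b] by metis
  have "z \<noteq> 0" using yz assms by auto
  have orth: "x \<bullet> z = 0" if "x \<in> span B" for x
    using yz(2)[OF that] by (simp add: orthogonal_def inner_commute)
  then have "b \<bullet> z = z \<bullet> z" using yz(1,3) by (simp add: inner_add_left)
  with \<open>z \<noteq> 0\<close> show thesis
    by (intro that[of "z /\<^sub>R (z \<bullet> z)"]) (simp_all add: orth span_base)
qed

text \<open>Averaging over translates along a direction \<open>w\<close> dual to \<open>b\<close> removes the factor of \<open>b\<close> and leaves the
  other factors unchanged.\<close>

lemma nn_integral_independent_finite:
  fixes B :: "'a::euclidean_space set" and \<theta> :: real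
  assumes "independent B" and \<theta>: "0 < \<theta>" "\<theta> < 1"
  shows "(\<integral>\<^sup>+x. indicator (ball 0 R) x * ennreal (\<Prod>b\<in>B. \<bar>b \<bullet> x\<bar> powr (- \<theta>)) \<partial>lborel) < \<infinity>"
proof -
  have "finite B" using assms(1) by (rule independent_imp_finite)
  then show ?thesis using assms(1)
  proof (induction B arbitrary: R rule: finite_induct)
    case empty
    have "emeasure lborel (ball (0::'a) R) < \<infinity>" by (rule emeasure_lborel_ball_finite)
    then show ?case by simp
  next
    case (insert b B)
    have ind: "independent B" and "b \<notin> span B"
      using insert.prems insert.hyps by (auto simp: independent_insert)
    then obtain w where w: "b \<bullet> w = 1" "\<And>x. x \<in> B \<Longrightarrow> x \<bullet> w = 0" using exists_dual_vector by metis
    obtain K :: real where K: "\<And>t. (\<integral>\<^sup>+s. indicator {0..1} s * ennreal (\<bar>t + s\<bar> powr (- \<theta>)) \<partial>lborel) \<le> ennreal K"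
      using nn_integral_shifted_powr_bounded[OF \<theta>] by metis
    define P where "P = (\<lambda>x. \<Prod>b\<in>B. \<bar>b \<bullet> x\<bar> powr (- \<theta>))"
    define F where "F = (\<lambda>x. indicator (ball 0 R) x * ennreal (\<bar>b \<bullet> x\<bar> powr (- \<theta>) * P x))"
    have [measurable]: "P \<in> borel_measurable borel" unfolding P_def by measurable
    have [measurable]: "ball (0::'a) r \<in> sets borel" for r by simp
    have [measurable]: "F \<in> borel_measurable borel" unfolding F_def by measurable
    have P0: "0 \<le> P x" for x unfolding P_def by (intro prod_nonneg) auto
    have Pw: "P (x + s *\<^sub>R w) = P x" for x s
      unfolding P_def using w by (intro prod.cong) (auto simp: inner_add_right)
    \<comment> \<open>A shift by \<open>s *\<^sub>R w\<close> with \<open>s\<close> in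
      \<open>{0..1}\<close> moves a point by at most \<open>norm w\<close>, so the induction
      hypothesis is applied on a larger ball; hence the induction is over arbitrary
      \<open>R\<close>.\<close>
    let ?R = "R + norm w"
    have "(\<integral>\<^sup>+x. F x \<partial>lborel) = (\<integral>\<^sup>+s. indicator {0..1::real} s * (\<integral>\<^sup>+x. F x \<partial>lborel) \<partial>lborel)"
      by (simp add: nn_integral_multc)
    also have "\<dots> = (\<integral>\<^sup>+s. (\<integral>\<^sup>+x. indicator {0..1} s * F (x + s *\<^sub>R w) \<partial>lborel) \<partial>lborel)"
      by (simp add: nn_integral_cmult nn_integral_lborel_translate)
    also have "\<dots> = (\<integral>\<^sup>+x. (\<integral>\<^sup>+s. indicator {0..1} s * F (x + s *\<^sub>R w) \<partial>lborel) \<partial>lborel)"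
      by (rule lborel_pair.Fubini') measurable
    also have "\<dots> \<le> (\<integral>\<^sup>+x. (\<integral>\<^sup>+s. indicator (ball 0 ?R) x * ennreal (P x) *
        (indicator {0..1} s * ennreal (\<bar>b \<bullet> x + s\<bar> powr (- \<theta>))) \<partial>lborel) \<partial>lborel)"
    proof (intro nn_integral_mono)
      fix x s
      show "indicator {0..1} s * F (x + s *\<^sub>R w) \<le> indicator (ball 0 ?R) x * ennreal (P x) *
        (indicator {0..1} s * ennreal (\<bar>b \<bullet> x + s\<bar> powr (- \<theta>)))"
      proof (cases "s \<in> {0..1} \<and> x + s *\<^sub>R w \<in> ball 0 R")
        case True
        have "norm x \<le> norm (x + s *\<^sub>R w) + norm (s *\<^sub>R w)"
          using norm_triangle_ineq4[of "x + s *\<^sub>R w" "s *\<^sub>R w"] by simp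
        also have "norm (s *\<^sub>R w) \<le> norm w" using True by (simp add: mult_left_le_one_le)
        finally have "norm x < ?R" using True by simp
        then show ?thesis using True w
          by (simp add: F_def Pw inner_add_right ennreal_mult P0 mult.commute)
      qed (auto simp: F_def)
    qed
    also have "\<dots> = (\<integral>\<^sup>+x. indicator (ball 0 ?R) x * ennreal (P x) *
        (\<integral>\<^sup>+s. indicator {0..1} s * ennreal (\<bar>b \<bullet> x + s\<bar> powr (- \<theta>)) \<partial>lborel) \<partial>lborel)"
      by (intro nn_integral_cong nn_integral_cmult) measurable
    also have "\<dots> \<le> (\<integral>\<^sup>+x. indicator (ball 0 ?R) x * ennreal (P x) * ennreal K \<partial>lborel)"
      by (intro nn_integral_mono mult_left_mono K) auto
    also have "\<dots> = (\<integral>\<^sup>+x. indicator (ball 0 ?R) x * ennreal (P x) \<partial>lborel) * ennreal K"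
      by (rule nn_integral_multc) measurable
    also have "\<dots> < \<infinity>"
      using insert.IH[OF ind, of ?R] unfolding P_def by (simp add: ennreal_mult_less_top)
    finally show ?case using insert.hyps by (simp add: F_def P_def)
  qed
qed

text \<open>The basis is the greedy one for the increasing order of \<open>u\<close>, as for maximum weight bases of
  matroids; the comparison of the two sums is Abel summation along that order.\<close>

lemma greedy_basis_bound:
  fixes S :: "'a::euclidean_space set" and u lam :: "'a \<Rightarrow> real" and \<theta> :: real
  assumes "finite S"
    and rank: "\<And>S'. S' \<subseteq> S \<Longrightarrow> (\<Sum>v\<in>S'. lam v) \<le> \<theta> * dim S'"
    and c: "\<And>v. v \<in> S \<Longrightarrow> u v \<le> c"
  shows "\<exists>B\<subseteq>S. independent B \<and> span B = span S \<and> (\<Sum>v\<in>S. lam v * (c - u v)) \<le> \<theta> * (\<Sum>v\<in>B. c - u v)"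
  using assms
proof (induction S arbitrary: c rule: finite_ranking_induct[where f = u])
  case empty
  then show ?case by (auto simp: independent_empty)
next
  case (insert p S)
  show ?case
  proof (cases "p \<in> S")
    case True
    then have "insert p S = S" by auto
    then show ?thesis using insert.IH[of c] insert.prems by auto
  next
    case False
    \<comment> \<open>The ranking induction adds a largest element, so \<open>u p\<close> bounds
      \<open>u\<close> on \<open>S\<close> and takes the place of \<open>c\<close>. Measured from
      \<open>u p\<close>, the new element contributes 0 on either side.\<close>
    have "\<exists>B\<subseteq>S. independent B \<and> span B = span S \<and> (\<Sum>v\<in>S. lam v * (u p - u v)) \<le> \<theta> * (\<Sum>v\<in>B. u p - u v)"
      using insert.prems(1) insert.hyps(2) by (intro insert.IH) blast+
    then obtain B where B: "B \<subseteq> S" "independent B" "span B = span S"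
      "(\<Sum>v\<in>S. lam v * (u p - u v)) \<le> \<theta> * (\<Sum>v\<in>B. u p - u v)" by blast
    define B' where "B' = (if p \<in> span B then B else insert p B)"
    have finB: "finite B" using B(1) insert.hyps(1) finite_subset by blast
    have sub: "B' \<subseteq> insert p S" using B(1) by (auto simp: B'_def)
    have ind: "independent B'"
      using B(2) by (auto simp: B'_def independent_insert)
    have spn: "span B' = span (insert p S)"
    proof (cases "p \<in> span B")
      case True
      then show ?thesis using B(3) by (simp add: B'_def span_redundant)
    next
      case False
      then show ?thesis using B(3) by (simp add: B'_def span_insert)
    qed
    have card: "dim (insert p S) = card B'"
      using ind spn by (metis dim_eq_card)
    have pB: "p \<notin> B" using False B(1) by auto
    have sumB': "(\<Sum>v\<in>B'. u p - u v) = (\<Sum>v\<in>B. u p - u v)"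
      using finB pB by (simp add: B'_def)
    have cp: "u p \<le> c" using insert.prems by auto
    \<comment> \<open>Raising the level from \<open>u p\<close> to \<open>c\<close> adds the total
      weight times \<open>c - u p\<close>. By the rank bound that weight is at most \<theta> times
      \<open>dim (insert p S) = card B'\<close>, which is what the right side gains per
      unit.\<close>
    have "(\<Sum>v\<in>insert p S. lam v * (c - u v)) =
        (\<Sum>v\<in>insert p S. lam v * (u p - u v)) + (\<Sum>v\<in>insert p S. lam v) * (c - u p)"
      unfolding sum_distrib_right sum.distrib[symmetric]
      by (intro sum.cong) (simp_all add: algebra_simps)
    also have "(\<Sum>v\<in>insert p S. lam v * (u p - u v)) = (\<Sum>v\<in>S. lam v * (u p - u v))"
      using False insert.hyps(1) by simp
    also have "\<dots> + (\<Sum>v\<in>insert p S. lam v) * (c - u p) \<le>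
        \<theta> * (\<Sum>v\<in>B'. u p - u v) + (\<theta> * dim (insert p S)) * (c - u p)"
      using B(4) cp unfolding sumB' by (intro add_mono mult_right_mono insert.prems(1)) auto
    also have "\<dots> = \<theta> * (\<Sum>v\<in>B'. c - u v)"
      by (simp add: card sum_subtractf algebra_simps)
    finally show ?thesis using sub ind spn by blast
  qed
qed

text \<open>In terms of \<open>u v = ln \<bar>v \<bullet> x\<bar> \<le> 0\<close> this is
  \<open>greedy_basis_bound\<close> at level 0, exponentiated. The greedy basis depends on the order
  of the \<open>u v\<close>, hence on \<open>x\<close>; the sum over all independent subsets covers
  every case.\<close>

lemma prod_powr_le_sum_independent:
  fixes S :: "'a::euclidean_space set" and lam :: "'a \<Rightarrow> real" and \<theta> :: real
  assumes fin: "finite S"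
    and rank: "\<And>S'. S' \<subseteq> S \<Longrightarrow> (\<Sum>v\<in>S'. lam v) \<le> \<theta> * dim S'"
    and small: "\<And>v. v \<in> S \<Longrightarrow> \<bar>v \<bullet> x\<bar> \<le> 1"
  shows "(\<Prod>v\<in>S. \<bar>v \<bullet> x\<bar> powr (- lam v)) \<le>
    (\<Sum>B\<in>{B. B \<subseteq> S \<and> independent B}. \<Prod>v\<in>B. \<bar>v \<bullet> x\<bar> powr (- \<theta>))"
proof (cases "\<exists>v\<in>S. v \<bullet> x = 0")
  case True
  \<comment> \<open>\<open>0 powr r\<close> is 0, so on the hyperplanes the left side vanishes
    instead of being infinite.\<close>
  then have "(\<Prod>v\<in>S. \<bar>v \<bullet> x\<bar> powr (- lam v)) = 0" using fin by (auto intro!: prod_zero)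
  then show ?thesis by (simp add: sum_nonneg prod_nonneg)
next
  case False
  define u where "u = (\<lambda>v. ln \<bar>v \<bullet> x\<bar>)"
  have pw: "\<bar>v \<bullet> x\<bar> powr r = exp (r * u v)" if "v \<in> S" for v r
    using False that by (simp add: u_def powr_def)
  have "u v \<le> 0" if "v \<in> S" for v
    using False that small[OF that] by (auto simp: u_def)
  then obtain B where B: "B \<subseteq> S" "independent B"
    "(\<Sum>v\<in>S. lam v * (0 - u v)) \<le> \<theta> * (\<Sum>v\<in>B. 0 - u v)"
    using greedy_basis_bound[OF fin rank, of u 0] by blast
  have finB: "finite B" using B(1) fin by (rule finite_subset)
  have "(\<Prod>v\<in>S. \<bar>v \<bullet> x\<bar> powr (- lam v)) = exp (\<Sum>v\<in>S. lam v * (0 - u v))"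
    using fin by (simp add: exp_sum pw)
  also have "\<dots> \<le> exp (\<theta> * (\<Sum>v\<in>B. 0 - u v))" using B(3) by simp
  also have "\<dots> = (\<Prod>v\<in>B. \<bar>v \<bullet> x\<bar> powr (- \<theta>))"
    unfolding sum_distrib_left exp_sum[OF finB] using B(1) by (intro prod.cong) (auto simp: pw)
  also have "\<dots> \<le> (\<Sum>B\<in>{B. B \<subseteq> S \<and> independent B}. \<Prod>v\<in>B. \<bar>v \<bullet> x\<bar> powr (- \<theta>))"
    using B fin by (intro member_le_sum) (auto intro: prod_nonneg)
  finally show ?thesis .
qed

text \<open>By compactness of the annulus, finiteness near each of its points \<open>p\<close>
  suffices. There the vectors not orthogonal to \<open>p\<close> give a bounded factor, and the
  others obey the strict rank inequalities because \<open>p\<close> is a nonzero common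
  zero.\<close>

lemma prod_powr_annulus_finite:
  fixes A :: "'a::euclidean_space set" and lam :: "'a \<Rightarrow> real"
  assumes fin: "finite A"
    and rank: "\<And>S x. S \<subseteq> A \<Longrightarrow> S \<noteq> {} \<Longrightarrow> x \<noteq> 0 \<Longrightarrow> (\<And>v. v \<in> S \<Longrightarrow> v \<bullet> x = 0) \<Longrightarrow>
        (\<Sum>v\<in>S. lam v) < real (dim S)"
    and r: "0 < r"
  shows "(\<integral>\<^sup>+x. indicator {x. r \<le> norm x \<and> norm x \<le> R} x *
     ennreal (\<Prod>v\<in>A. \<bar>v \<bullet> x\<bar> powr (- lam v)) \<partial>lborel) < \<infinity>"
proof -
  define W where "W = (\<lambda>x. \<Prod>v\<in>A. \<bar>v \<bullet> x\<bar> powr (- lam v))"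
  have [measurable]: "W \<in> borel_measurable borel" unfolding W_def by measurable
  have [measurable]: "ball (x::'a) r \<in> sets borel" for x r by simp
  have local: "\<exists>e>0. (\<integral>\<^sup>+x. indicator (ball p e) x * ennreal (W x) \<partial>lborel) < \<infinity>" if "p \<noteq> 0" for p
  proof -
    define S where "S = {v \<in> A. v \<bullet> p = 0}"
    have S: "finite S" "S \<subseteq> A" using fin by (auto simp: S_def)
    \<comment> \<open>Finitely many strict inequalities leave room for one common \<theta> below 1;
      the empty set only gives \<open>0 \<le> 0\<close>.\<close>
    have "\<forall>\<^sub>F \<theta> in at_left 1. \<forall>S'\<in>Pow S. (\<Sum>v\<in>S'. lam v) \<le> \<theta> * real (dim S')"
    proof (intro eventually_ball_finite ballI)
      fix S' assume S': "S' \<in> Pow S"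
      show "\<forall>\<^sub>F \<theta> in at_left 1. (\<Sum>v\<in>S'. lam v) \<le> \<theta> * real (dim S')"
      proof (cases "S' = {}")
        case False
        have "(\<Sum>v\<in>S'. lam v) < real (dim S')"
          using S' S False that by (intro rank[of S' p]) (auto simp: S_def)
        moreover have "((\<lambda>\<theta>. \<theta> * real (dim S')) \<longlongrightarrow> 1 * real (dim S')) (at_left 1)"
          by (intro tendsto_intros)
        ultimately have "\<forall>\<^sub>F \<theta> in at_left 1. (\<Sum>v\<in>S'. lam v) < \<theta> * real (dim S')"
          by (intro order_tendstoD(1)) auto
        then show ?thesis by eventually_elim simp
      qed simp
    qed (use S in auto)
    moreover have "\<forall>\<^sub>F \<theta>::real in at_left 1. 0 < \<theta> \<and> \<theta> < 1"
      using eventually_at_left_real[of 0 1] by (auto elim: eventually_mono)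
    ultimately have "\<forall>\<^sub>F \<theta> in at_left 1. (\<forall>S'\<in>Pow S. (\<Sum>v\<in>S'. lam v) \<le> \<theta> * real (dim S')) \<and> 0 < \<theta> \<and> \<theta> < 1"
      by eventually_elim blast
    then obtain \<theta> :: real where \<theta>: "\<And>S'. S' \<subseteq> S \<Longrightarrow> (\<Sum>v\<in>S'. lam v) \<le> \<theta> * real (dim S')" "0 < \<theta>" "\<theta> < 1"
      using eventually_happens[of _ "at_left (1::real)"] trivial_limit_at_left_real by blast
    define q where "q = (\<lambda>x. \<Prod>v\<in>A - S. \<bar>v \<bullet> x\<bar> powr (- lam v))"
    have "isCont q p"
      unfolding q_def by (intro continuous_intros) (auto simp: S_def)
    then have "\<forall>\<^sub>F x in nhds p. q x < q p + 1"
      by (intro order_tendstoD(2)[of q "q p"]) (auto simp: isCont_def tendsto_at_iff_tendsto_nhds)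
    moreover have "\<forall>\<^sub>F x in nhds p. \<forall>v\<in>S. \<bar>v \<bullet> x\<bar> < 1"
    proof (intro eventually_ball_finite ballI S)
      fix v assume "v \<in> S"
      then have "((\<lambda>x. \<bar>v \<bullet> x\<bar>) \<longlongrightarrow> 0) (nhds p)"
        by (auto simp: S_def intro!: tendsto_eq_intros filterlim_ident)
      then show "\<forall>\<^sub>F x in nhds p. \<bar>v \<bullet> x\<bar> < 1" by (rule order_tendstoD) simp
    qed
    ultimately have "\<forall>\<^sub>F x in nhds p. q x < q p + 1 \<and> (\<forall>v\<in>S. \<bar>v \<bullet> x\<bar> < 1)"
      by eventually_elim blast
    then obtain e where e: "e > 0" "\<And>x. dist x p < e \<Longrightarrow> q x < q p + 1 \<and> (\<forall>v\<in>S. \<bar>v \<bullet> x\<bar> < 1)"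
      unfolding eventually_nhds_metric by blast
    have q0: "0 \<le> q x" for x unfolding q_def by (intro prod_nonneg) auto
    let ?R = "norm p + e" and ?\<B> = "{B. B \<subseteq> S \<and> independent B}"
    define M where "M = (\<lambda>B (x::'a). \<Prod>v\<in>B. \<bar>v \<bullet> x\<bar> powr (- \<theta>))"
    have M0: "0 \<le> M B x" for B x unfolding M_def by (intro prod_nonneg) auto
    have [measurable]: "M B \<in> borel_measurable borel" for B unfolding M_def by measurable
    have "indicator (ball p e) x * ennreal (W x) \<le>
        ennreal (q p + 1) * (\<Sum>B\<in>?\<B>. indicator (ball 0 ?R) x * ennreal (M B x))" for x
    proof (cases "x \<in> ball p e")
      case True
      have "norm x \<le> norm p + norm (x - p)" using norm_triangle_ineq[of p "x - p"] by simp
      then have xR: "x \<in> ball 0 ?R" using True by (simp add: dist_norm norm_minus_commute)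
      have ex: "q x < q p + 1" "\<And>v. v \<in> S \<Longrightarrow> \<bar>v \<bullet> x\<bar> < 1" using True e(2)[of x] by (auto simp: dist_commute)
      have "W x = q x * (\<Prod>v\<in>S. \<bar>v \<bullet> x\<bar> powr (- lam v))"
        unfolding W_def q_def using prod.subset_diff[OF S(2) fin] by simp
      also have "\<dots> \<le> (q p + 1) * (\<Sum>B\<in>?\<B>. M B x)"
        unfolding M_def using ex q0 prod_powr_le_sum_independent[OF S(1) \<theta>(1), of x]
        by (intro mult_mono) (auto simp: less_imp_le intro: prod_nonneg add_nonneg_nonneg)
      finally have "ennreal (W x) \<le> ennreal ((q p + 1) * (\<Sum>B\<in>?\<B>. M B x))" by (rule ennreal_leI)
      also have "\<dots> = ennreal (q p + 1) * (\<Sum>B\<in>?\<B>. ennreal (M B x))"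
        using q0 M0 by (simp add: ennreal_mult sum_nonneg sum_ennreal)
      finally show ?thesis using True xR by simp
    qed simp
    then have "(\<integral>\<^sup>+x. indicator (ball p e) x * ennreal (W x) \<partial>lborel) \<le>
        (\<integral>\<^sup>+x. ennreal (q p + 1) * (\<Sum>B\<in>?\<B>. indicator (ball 0 ?R) x * ennreal (M B x)) \<partial>lborel)"
      by (intro nn_integral_mono)
    also have "\<dots> = ennreal (q p + 1) * (\<Sum>B\<in>?\<B>. \<integral>\<^sup>+x. indicator (ball 0 ?R) x * ennreal (M B x) \<partial>lborel)"
      by (subst nn_integral_cmult, measurable) (subst nn_integral_sum, auto)
    also have "\<dots> < \<infinity>"
      using S nn_integral_independent_finite[OF _ \<theta>(2,3)]
      unfolding M_def by (auto simp: ennreal_mult_less_top)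
    finally show ?thesis using e(1) by blast
  qed
  let ?K = "{x::'a. r \<le> norm x \<and> norm x \<le> R}"
  have "?K = cball 0 R - ball 0 r" by auto
  then have "compact ?K" by (simp add: compact_diff)
  obtain e where e: "\<And>p. p \<in> ?K \<Longrightarrow> e p > 0 \<and> (\<integral>\<^sup>+x. indicator (ball p (e p)) x * ennreal (W x) \<partial>lborel) < \<infinity>"
  proof -
    have "\<forall>p\<in>?K. \<exists>e>0. (\<integral>\<^sup>+x. indicator (ball p e) x * ennreal (W x) \<partial>lborel) < \<infinity>"
    proof
      fix p assume "p \<in> ?K"
      then have "p \<noteq> 0" using r by auto
      then show "\<exists>e>0. (\<integral>\<^sup>+x. indicator (ball p e) x * ennreal (W x) \<partial>lborel) < \<infinity>" by (rule local)
    qed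
    from bchoice[OF this] show ?thesis using that by blast
  qed
  obtain C where C: "C \<subseteq> ?K" "finite C" "?K \<subseteq> (\<Union>p\<in>C. ball p (e p))"
  proof (rule compactE_image[OF \<open>compact ?K\<close>, of ?K "\<lambda>p. ball p (e p)"])
    have "p \<in> ball p (e p)" if "p \<in> ?K" for p using e[OF that] by simp
    then show "?K \<subseteq> (\<Union>p\<in>?K. ball p (e p))" by blast
  qed (simp_all add: that)
  have "(\<integral>\<^sup>+x. indicator ?K x * ennreal (W x) \<partial>lborel) \<le>
      (\<integral>\<^sup>+x. (\<Sum>p\<in>C. indicator (ball p (e p)) x * ennreal (W x)) \<partial>lborel)"
  proof (rule nn_integral_mono)
    fix x
    show "indicator ?K x * ennreal (W x) \<le> (\<Sum>p\<in>C. indicator (ball p (e p)) x * ennreal (W x))"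
    proof (cases "x \<in> ?K")
      case True
      then obtain p where p: "p \<in> C" "x \<in> ball p (e p)" using C(3) by auto
      then have "indicator ?K x * ennreal (W x) \<le> indicator (ball p (e p)) x * ennreal (W x)"
        by (auto simp: indicator_def)
      also have "\<dots> \<le> (\<Sum>p\<in>C. indicator (ball p (e p)) x * ennreal (W x))"
        using p(1) C(2) by (intro member_le_sum) auto
      finally show ?thesis .
    qed simp
  qed
  also have "\<dots> = (\<Sum>p\<in>C. \<integral>\<^sup>+x. indicator (ball p (e p)) x * ennreal (W x) \<partial>lborel)"
    by (rule nn_integral_sum) measurable
  also have "\<dots> < \<infinity>"
    using e C(1,2) by auto
  finally show ?thesis by (simp add: W_def)
qed

section \<open>Chamber periods\<close>

lemma mem_arrangement_complement:
  "x \<in> UNIV - \<Union>(arrangement l m) \<longleftrightarrow> (\<forall>j\<in>{1..m}. l j x \<noteq> 0)"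
  by (auto simp: arrangement_def hyperplane_def)

text \<open>By the intermediate value theorem no form changes sign on the connected set
  \<open>D\<close>. Conversely the sign cell is convex and avoids the hyperplanes, so it lies inside
  one component.\<close>

lemma chamber_eq_sign_cell:
  fixes l :: "nat \<Rightarrow> 'a::euclidean_space \<Rightarrow> real"
  assumes lin: "\<And>j. j \<in> {1..m} \<Longrightarrow> linear (l j)"
    and D: "D \<in> chambers (arrangement l m)" and x: "x \<in> D"
  shows "D = {y. \<forall>j\<in>{1..m}. 0 < l j x * l j y}"
proof
  let ?K = "UNIV - \<Union>(arrangement l m)" and ?Z = "{y. \<forall>j\<in>{1..m}. 0 < l j x * l j y}"
  have DK: "D \<subseteq> ?K" and con: "connected D" and comp: "D \<in> components ?K"
    using D in_components_subset in_components_connected unfolding chambers_def by blast+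
  have xnz: "l j x \<noteq> 0" if "j \<in> {1..m}" for j
    using x DK that mem_arrangement_complement[of x l m] by blast
  then have xx: "0 < l j x * l j x" if "j \<in> {1..m}" for j
    using that not_real_square_gt_zero by blast
  show "D \<subseteq> ?Z"
  proof (clarify, rule ccontr)
    fix y j assume y: "y \<in> D" and j: "j \<in> {1..m}" and "\<not> 0 < l j x * l j y"
    moreover have "continuous_on D (\<lambda>y. l j x * l j y)"
      using lin[OF j] by (intro continuous_intros linear_continuous_on) (simp add: linear_conv_bounded_linear)
    then have "connected ((\<lambda>y. l j x * l j y) ` D)" using con by (rule connected_continuous_image)
    ultimately have "0 \<in> (\<lambda>y. l j x * l j y) ` D"
      using x xx[OF j] by (intro connectedD_interval[of _ "l j x * l j y" "l j x * l j x" 0]) auto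
    then obtain z where "z \<in> D" "l j z = 0" using xnz[OF j] by auto
    then show False using DK j mem_arrangement_complement[of z l m] by blast
  qed
  have "convex ?Z"
  proof (rule convexI, clarify)
    fix y z u v and j
    assume yz: "\<forall>j\<in>{1..m}. 0 < l j x * l j y" "\<forall>j\<in>{1..m}. 0 < l j x * l j z"
      and uv: "0 \<le> u" "0 \<le> v" "u + v = (1::real)" and j: "j \<in> {1..m}"
    have "0 < u * (l j x * l j y) + v * (l j x * l j z)"
    proof (cases "u = 0")
      case False
      then have "0 < u * (l j x * l j y)" using yz(1) uv(1) j by (intro mult_pos_pos[of u]) auto
      moreover have "0 \<le> v * (l j x * l j z)"
        using yz(2) uv(2) j by (intro mult_nonneg_nonneg[of v]) (auto simp: less_imp_le)
      ultimately show ?thesis by simp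
    qed (use yz uv j in auto)
    then show "0 < l j x * l j (u *\<^sub>R y + v *\<^sub>R z)"
      using lin[OF j] by (simp add: linear_add linear_scale algebra_simps)
  qed
  then have "connected ?Z" by (rule convex_connected)
  moreover have "?Z \<subseteq> ?K"
    using mem_arrangement_complement[of _ l m] by force
  moreover have "x \<in> ?Z" using xx by blast
  ultimately show "?Z \<subseteq> D" using comp x by (intro components_maximal[OF comp]) auto
qed

lemma separates_hyperplane_iff:
  fixes l :: "nat \<Rightarrow> 'a::euclidean_space \<Rightarrow> real"
  assumes lin: "\<And>j. j \<in> {1..m} \<Longrightarrow> linear (l j)" and j: "j \<in> {1..m}"
    and C: "C \<in> chambers (arrangement l m)" "c \<in> C" and D: "D \<in> chambers (arrangement l m)" "d \<in> D"
  shows "separates (hyperplane l j) C D \<longleftrightarrow> l j c * l j d < 0"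
proof
  note Ceq = chamber_eq_sign_cell[OF lin C] and Deq = chamber_eq_sign_cell[OF lin D]
  have sC: "0 < l j c * l j y" if "y \<in> C" for y using that Ceq j by auto
  have sD: "0 < l j d * l j y" if "y \<in> D" for y using that Deq j by auto
  have linj: "linear (l j)" by (rule lin[OF j])
  {
    assume "separates (hyperplane l j) C D"
    then obtain f :: "'a \<Rightarrow> real" where f: "linear f" "hyperplane l j = {x. f x = 0}"
      and "\<forall>x\<in>C. f x < 0" "\<forall>x\<in>D. f x > 0"
      unfolding separates_def by blast
    then have fcd: "f c < 0" "f d > 0" using C(2) D(2) by auto
    \<comment> \<open>This vector is in the kernel of \<open>f\<close>, hence in that of
      \<open>l j\<close>; so \<open>l j c\<close> and \<open>l j d\<close> are in the ratio of
      \<open>f c\<close> and \<open>f d\<close>, whose signs differ.\<close>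
    have "f (f d *\<^sub>R c - f c *\<^sub>R d) = 0" using f(1) by (simp add: linear_diff linear_scale)
    then have "l j (f d *\<^sub>R c - f c *\<^sub>R d) = 0" using f(2) by (auto simp: hyperplane_def)
    then have eq: "f d * l j c = f c * l j d" using linj by (simp add: linear_diff linear_scale)
    have "f d * (l j c * l j d) = f c * (l j d * l j d)"
      using arg_cong[OF eq, of "\<lambda>t. t * l j d"] by (simp add: mult.assoc)
    moreover have "f c * (l j d * l j d) < 0" using fcd(1) sD[OF D(2)] by (rule mult_neg_pos)
    ultimately have "f d * (l j c * l j d) < 0" by (simp only:)
    then show "l j c * l j d < 0" using fcd(2) by (metis mult_less_0_iff order_less_asym)
  }
  {
    assume neg: "l j c * l j d < 0"
    define f where "f = (\<lambda>x. l j d * l j x)"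
    have "linear f" unfolding f_def using linear_compose_scale_right[OF linj, of "l j d"] by simp
    moreover have "hyperplane l j = {x. f x = 0}" using neg by (auto simp: hyperplane_def f_def)
    moreover have "f x < 0" if "x \<in> C" for x
      using neg sC[OF that] by (auto simp: f_def zero_less_mult_iff mult_less_0_iff)
    moreover have "f x > 0" if "x \<in> D" for x using sD[OF that] by (simp add: f_def)
    ultimately show "separates (hyperplane l j) C D" unfolding separates_def by blast
  }
qed

lemma AE_lborel_inner_nonzero:
  fixes v :: "'a::euclidean_space"
  assumes "v \<noteq> 0"
  shows "AE x in lborel. v \<bullet> x \<noteq> 0"
proof -
  have "negligible {x. v \<bullet> x = 0}" using assms by (intro negligible_hyperplane) auto
  moreover have "{x. v \<bullet> x = 0} \<in> sets borel" by (intro borel_closed closed_hyperplane)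
  ultimately have "{x. v \<bullet> x = 0} \<in> null_sets lborel"
    by (simp add: negligible_iff_null_sets null_sets_completion_iff)
  then show ?thesis using AE_not_in by fastforce
qed

section \<open>The homogeneous weight and the conical chambers\<close>

definition arrangement_weight ::
  "(nat \<Rightarrow> 'a \<Rightarrow> real) \<Rightarrow> (nat \<Rightarrow> real) \<Rightarrow> nat \<Rightarrow> 'a \<Rightarrow> real" where
  "arrangement_weight l lam m x = (\<Prod>j=1..m. \<bar>l j x\<bar> powr (- lam j))"

locale balanced_arrangement =
  fixes l :: "nat \<Rightarrow> real^'n \<Rightarrow> real" and m :: nat and lam :: "nat \<Rightarrow> real"
  assumes lin: "\<And>j. j \<in> {1..m} \<Longrightarrow> linear (l j)"
    and nonzero: "\<And>j. j \<in> {1..m} \<Longrightarrow> l j \<noteq> (\<lambda>x. 0)"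
    and distinct: "inj_on (hyperplane l) {1..m}"
    and lam_bounds: "\<And>j. j \<in> {1..m} \<Longrightarrow> 0 < lam j \<and> lam j < 1"
    and lam_sum: "(\<Sum>j=1..m. lam j) = real CARD('n)"
    and lam_flats: "\<And>X. X \<in> intersection_flats (arrangement l m) \<Longrightarrow> X \<noteq> {0} \<Longrightarrow> X \<noteq> UNIV \<Longrightarrow>
          (\<Sum>j | j \<in> {1..m} \<and> X \<subseteq> hyperplane l j. lam j) < real (codim X)"
begin

abbreviation \<A> where "\<A> \<equiv> arrangement l m"
abbreviation W where "W \<equiv> arrangement_weight l lam m"

text \<open>The Riesz vector of \<open>l j\<close>, through which the results on inner products with
  finite sets of vectors apply.\<close>

definition normal :: "nat \<Rightarrow> real^'n" where "normal j = adjoint (l j) 1"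

lemma l_eq_inner: "j \<in> {1..m} \<Longrightarrow> l j x = normal j \<bullet> x"
  using adjoint_works[OF lin, of j x 1] by (simp add: normal_def inner_commute)

lemma normal_nonzero: "j \<in> {1..m} \<Longrightarrow> normal j \<noteq> 0"
proof
  assume "j \<in> {1..m}" "normal j = 0"
  then have "l j = (\<lambda>x. 0)" using l_eq_inner[of j] by (simp add: fun_eq_iff)
  then show False using nonzero \<open>j \<in> {1..m}\<close> by blast
qed

lemma inj_on_normal: "inj_on normal {1..m}"
proof (rule inj_onI)
  fix i j assume ij: "i \<in> {1..m}" "j \<in> {1..m}" "normal i = normal j"
  then have "hyperplane l i = hyperplane l j" by (simp only: hyperplane_def l_eq_inner)
  then show "i = j" using distinct ij(1,2) by (simp only: inj_on_eq_iff)
qed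

lemma measurable_l: "j \<in> {1..m} \<Longrightarrow> l j \<in> borel_measurable borel"
  using lin by (intro borel_measurable_continuous_onI linear_continuous_on)
    (simp add: linear_conv_bounded_linear)

lemma measurable_W [measurable]: "W \<in> borel_measurable borel"
proof -
  have "(\<lambda>x. \<bar>l j x\<bar> powr (- lam j)) \<in> borel_measurable borel" if "j \<in> {1..m}" for j
    using measurable_l[OF that] by measurable
  then show ?thesis unfolding arrangement_weight_def by (rule borel_measurable_prod)
qed

lemma W_nonneg: "0 \<le> W x"
  unfolding arrangement_weight_def by (intro prod_nonneg) auto

text \<open>The exponents sum to \<open>CARD('n)\<close>, so the degree of \<open>W\<close> is
  opposite to that of the Jacobian of a dilation.\<close>

lemma W_scale: "t > 0 \<Longrightarrow> t ^ CARD('n) * W (t *\<^sub>R x) = W x"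
proof -
  assume t: "t > 0"
  have "W (t *\<^sub>R x) = (\<Prod>j=1..m. t powr (- lam j) * \<bar>l j x\<bar> powr (- lam j))"
    unfolding arrangement_weight_def using t lin
    by (intro prod.cong) (auto simp: linear_scale abs_mult powr_mult)
  also have "\<dots> = t powr (- real CARD('n)) * W x"
    using powr_sum[OF t, of "{1..m}" "\<lambda>j. - lam j"] lam_sum
    by (simp add: prod.distrib sum_negf arrangement_weight_def)
  finally show ?thesis using t by (simp add: powr_minus powr_realpow)
qed

lemma chamber_form_nonzero: "D \<in> chambers \<A> \<Longrightarrow> x \<in> D \<Longrightarrow> j \<in> {1..m} \<Longrightarrow> l j x \<noteq> 0"
  using in_components_subset[of D "UNIV - \<Union>\<A>"] mem_arrangement_complement[of x l m]
  unfolding chambers_def by auto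

lemma chamber_nonempty: "D \<in> chambers \<A> \<Longrightarrow> \<exists>x. x \<in> D"
  unfolding chambers_def using in_components_nonempty[of D] by auto

lemma open_chamber:
  assumes "D \<in> chambers \<A>" shows "open D"
proof -
  obtain x where x: "x \<in> D" using chamber_nonempty[OF assms] by blast
  have "D = (\<Inter>j\<in>{1..m}. {y. 0 < l j x * (normal j \<bullet> y)})"
    using chamber_eq_sign_cell[OF lin assms x] by (auto simp: l_eq_inner)
  also have "open \<dots>" by (intro open_INT ballI open_Collect_less continuous_intros) auto
  finally show ?thesis .
qed

lemma chamber_cone:
  assumes "D \<in> chambers \<A>" "t > 0"
  shows "t *\<^sub>R x \<in> D \<longleftrightarrow> x \<in> D"
proof -
  have sub: "s *\<^sub>R y \<in> D" if "s > 0" "y \<in> D" for s y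
  proof -
    have "0 < l j y * l j (s *\<^sub>R y)" if j: "j \<in> {1..m}" for j
    proof -
      have "0 < l j y * l j y"
        using chamber_form_nonzero[OF assms(1) \<open>y \<in> D\<close> j] not_real_square_gt_zero by blast
      then have "0 < s * (l j y * l j y)" using \<open>s > 0\<close> by (rule mult_pos_pos[rotated])
      then show ?thesis using lin[OF j] by (simp add: linear_scale mult.left_commute)
    qed
    then show ?thesis using chamber_eq_sign_cell[OF lin assms(1) \<open>y \<in> D\<close>] by blast
  qed
  show ?thesis using sub[of t x] sub[of "inverse t" "t *\<^sub>R x"] assms(2) by auto
qed

lemma ex_chamber:
  assumes "\<And>j. j \<in> {1..m} \<Longrightarrow> l j x \<noteq> 0"
  shows "\<exists>D\<in>chambers \<A>. x \<in> D"
proof -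
  have "x \<in> \<Union>(components (UNIV - \<Union>\<A>))"
    unfolding Union_components using mem_arrangement_complement[of x l m] assms by blast
  then show ?thesis unfolding chambers_def by blast
qed

section \<open>Periods as integrals over truncated cones\<close>

text \<open>The cone description of \<open>spherical_measure\<close> turns the period into an
  integral over the unit ball, and homogeneity rewrites \<open>W (sgn x)\<close> as
  \<open>norm x ^ CARD('n) * W x\<close>. This is the shape that
  \<open>nn_integral_homogeneous_swap\<close> takes.\<close>

lemma chamber_period_eq_radial:
  assumes D: "D \<in> chambers \<A>"
  shows "chamber_period l lam m D =
    (\<integral>\<^sup>+x. ennreal (real CARD('n) * norm x ^ CARD('n)) * indicator {..1} (norm x) *
       (ennreal (W x) * indicator D x) \<partial>lborel)"
proof -
  have [measurable]: "D \<in> sets borel" using open_chamber[OF D] by simp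
  have [measurable]: "sgn \<in> borel_measurable (borel :: (real^'n) measure)" by measurable
  have [measurable]: "(\<lambda>x. of_nat CARD('n) * indicator (cball 0 1) x :: ennreal) \<in>
      borel_measurable (borel :: (real^'n) measure)"
    by (intro borel_measurable_times_ennreal borel_measurable_indicator) auto
  have [measurable]: "(\<lambda>x. ennreal (W x) * indicator (D \<inter> sphere 0 1) x) \<in> borel_measurable borel"
    by (intro borel_measurable_times_ennreal borel_measurable_indicator) auto
  have "chamber_period l lam m D =
      (\<integral>\<^sup>+x. of_nat CARD('n) * indicator (cball 0 1) x *
         (ennreal (W (sgn x)) * indicator (D \<inter> sphere 0 1) (sgn x)) \<partial>(lborel :: (real^'n) measure))"
    unfolding chamber_period_def spherical_measure_def arrangement_weight_def[symmetric]
    by (subst nn_integral_distr, measurable) (subst nn_integral_density, auto)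
  also have "\<dots> = (\<integral>\<^sup>+x. ennreal (real CARD('n) * norm x ^ CARD('n)) * indicator {..1} (norm x) *
       (ennreal (W x) * indicator D x) \<partial>lborel)"
  proof (rule nn_integral_cong_AE)
    have "AE x in lborel. x \<noteq> (0 :: real^'n)" by (rule AE_lborel_singleton)
    then show "AE x in lborel. of_nat CARD('n) * indicator (cball 0 1) x *
         (ennreal (W (sgn x)) * indicator (D \<inter> sphere 0 1) (sgn x)) =
       ennreal (real CARD('n) * norm x ^ CARD('n)) * indicator {..1} (norm x) *
       (ennreal (W x) * indicator D (x :: real^'n))"
    proof eventually_elim
      case (elim x)
      have "sgn x \<in> D \<longleftrightarrow> x \<in> D"
        using elim chamber_cone[OF D, of "inverse (norm x)" x] by (simp add: sgn_div_norm divide_inverse_commute)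
      moreover have "sgn x \<in> sphere 0 1" using elim by (simp add: norm_sgn)
      moreover have "W (sgn x) = norm x ^ CARD('n) * W x"
        using W_scale[of "norm x" "sgn x"] elim by (simp add: sgn_div_norm)
      ultimately show ?case
        by (auto simp: indicator_def ennreal_mult W_nonneg ennreal_of_nat_eq_real_of_nat mult.assoc)
    qed
  qed
  finally show ?thesis .
qed

text \<open>Replacing \<open>s\<close> by \<open>- s\<close> gives the exponential density of rate
  \<open>n\<close>, of total mass one.\<close>

lemma nn_integral_radial_factor:
  "(\<integral>\<^sup>+s. ennreal (real n * exp s ^ n) * indicator {..1} (exp s) \<partial>lborel) = 1" if "n > 0"
proof -
  have "(\<integral>\<^sup>+s. ennreal (real n * exp s ^ n) * indicator {..1} (exp s) \<partial>lborel) =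
     (\<integral>\<^sup>+s. ennreal (real n * exp (- s) ^ n) * indicator {..1} (exp (- s)) \<partial>lborel)"
    using nn_integral_real_affine[of "\<lambda>s. ennreal (real n * exp s ^ n) * indicator {..1} (exp s)" "-1" 0]
    by simp
  also have "\<dots> = (\<integral>\<^sup>+s. ennreal (real n * exp (- (real n * s))) * indicator {0..} s \<partial>lborel)"
    by (intro nn_integral_cong) (auto simp: indicator_def simp flip: exp_of_nat_mult)
  also have "\<dots> = ennreal (0 - (- exp (- (real n * 0))))"
  proof (rule nn_integral_FTC_atLeast)
    show "((\<lambda>s. - exp (- (real n * s))) \<longlongrightarrow> 0) at_top"
      using that by real_asymp
    show "((\<lambda>s. - exp (- (real n * s))) has_real_derivative real n * exp (- (real n * s))) (at s)" for s
      by (auto intro!: derivative_eq_intros)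
  qed auto
  finally show ?thesis by simp
qed

text \<open>The radial cut-off and \<open>indicator {1..exp 1}\<close> both have integral 1 in the
  logarithmic variable, so the swap exchanges \<open>norm\<close> for \<rho> with no constant.
  Positivity almost everywhere lets \<rho> be the absolute value of a nonzero linear form.\<close>

lemma chamber_period_eq:
  assumes D: "D \<in> chambers \<A>" and [measurable]: "\<rho> \<in> borel_measurable borel"
    and hom: "\<And>t x. t > 0 \<Longrightarrow> \<rho> (t *\<^sub>R x) = t * \<rho> x" and pos: "AE x in lborel. \<rho> x > 0"
  shows "chamber_period l lam m D =
    (\<integral>\<^sup>+x. indicator {1..exp 1} (\<rho> x) * (ennreal (W x) * indicator D x) \<partial>lborel)"
proof -
  have [measurable]: "D \<in> sets borel" using open_chamber[OF D] by simp
  let ?\<psi> = "\<lambda>r. ennreal (real CARD('n) * r ^ CARD('n)) * indicator {..1} r"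
  have "(\<integral>\<^sup>+x. ?\<psi> (norm x) * (ennreal (W x) * indicator D x) \<partial>lborel) *
      (\<integral>\<^sup>+s. indicator {1..exp 1} (exp s :: real) \<partial>lborel) =
    (\<integral>\<^sup>+x. indicator {1..exp 1} (\<rho> x) * (ennreal (W x) * indicator D x) \<partial>lborel) *
      (\<integral>\<^sup>+s. ?\<psi> (exp s) \<partial>lborel)"
  proof (rule nn_integral_homogeneous_swap)
    fix t :: real and x :: "real^'n" assume t: "t > 0"
    show "ennreal (t ^ DIM(real^'n)) * (ennreal (W (t *\<^sub>R x)) * indicator D (t *\<^sub>R x)) = ennreal (W x) * indicator D x"
      using W_scale[OF t, of x] chamber_cone[OF D t, of x] t
      by (auto simp: indicator_def simp flip: ennreal_mult' intro: W_nonneg)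
    show "norm (t *\<^sub>R x) = t * norm x" using t by simp
    show "\<rho> (t *\<^sub>R x) = t * \<rho> x" by (rule hom[OF t])
  next
    show "AE x in lborel. 0 < norm (x::real^'n)" using AE_lborel_singleton[of 0] by simp
    show "AE x in lborel. 0 < \<rho> x" by (rule pos)
    show "(\<lambda>x. ennreal (W x) * indicator D x) \<in> borel_measurable borel"
      by (intro borel_measurable_times_ennreal borel_measurable_indicator) auto
    show "?\<psi> \<in> borel_measurable borel"
      by (intro borel_measurable_times_ennreal borel_measurable_indicator) auto
  qed auto
  moreover have "(\<integral>\<^sup>+s. indicator {1..exp 1} (exp s :: real) \<partial>lborel) = (\<integral>\<^sup>+s. indicator {0..1::real} s \<partial>lborel)"
    by (intro nn_integral_cong) (auto simp: indicator_def)
  ultimately show ?thesis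
    using nn_integral_radial_factor[of "CARD('n)"] by (simp add: chamber_period_eq_radial[OF D])
qed

section \<open>Finiteness from the condition on flats\<close>

text \<open>The common zero set \<open>X\<close> of the forms in \<open>J\<close> is a flat, nonzero
  since it contains \<open>x\<close> and proper since \<open>J\<close> is nonempty. It is the
  orthogonal complement of the normals, so its codimension is their rank. The condition on flats
  also counts any further hyperplanes through \<open>X\<close>, which only strengthens it as the
  \<open>lam j\<close> are positive.\<close>

lemma sum_lam_less_dim:
  assumes J: "J \<subseteq> {1..m}" "J \<noteq> {}" and x: "x \<noteq> 0" "\<And>j. j \<in> J \<Longrightarrow> l j x = 0"
  shows "(\<Sum>j\<in>J. lam j) < real (dim (normal ` J))"
proof -
  define X where "X = \<Inter>(hyperplane l ` J)"
  have flat: "X \<in> intersection_flats \<A>"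
    unfolding X_def intersection_flats_def arrangement_def using J(1) by blast
  have X0: "X \<noteq> {0}" using x by (auto simp: X_def hyperplane_def)
  have XU: "X \<noteq> UNIV"
  proof
    assume "X = UNIV"
    then obtain j where j: "j \<in> J" "hyperplane l j = UNIV" using J(2) by (auto simp: X_def)
    then have "l j = (\<lambda>x. 0)" by (auto simp: hyperplane_def set_eq_iff)
    then show False using nonzero[of j] J(1) j(1) by blast
  qed
  have Xorth: "X = {y \<in> UNIV. \<forall>v\<in>span (normal ` J). orthogonal v y}"
  proof -
    have l_J: "l j y = normal j \<bullet> y" if "j \<in> J" for j y using that J(1) l_eq_inner by blast
    have "X = {y. \<forall>v\<in>normal ` J. orthogonal y v}"
      by (simp add: X_def hyperplane_def orthogonal_def l_J inner_commute set_eq_iff)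
    also have "\<dots> = {y \<in> UNIV. \<forall>v\<in>span (normal ` J). orthogonal v y}"
    proof (intro Collect_cong iffI)
      fix y assume "\<forall>v\<in>normal ` J. orthogonal y v"
      then show "y \<in> UNIV \<and> (\<forall>v\<in>span (normal ` J). orthogonal v y)"
        using orthogonal_to_span[of _ "normal ` J" y] orthogonal_commute by blast
    next
      fix y assume "y \<in> UNIV \<and> (\<forall>v\<in>span (normal ` J). orthogonal v y)"
      then show "\<forall>v\<in>normal ` J. orthogonal y v"
        using span_base[of _ "normal ` J"] orthogonal_commute by blast
    qed
    finally show ?thesis .
  qed
  have "dim X + dim (span (normal ` J)) = dim (UNIV :: (real^'n) set)"
    unfolding Xorth by (rule dim_subspace_orthogonal_to_vectors) auto
  then have cod: "codim X = dim (normal ` J)" by (simp add: codim_def)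
  have "(\<Sum>j\<in>J. lam j) \<le> (\<Sum>j | j \<in> {1..m} \<and> X \<subseteq> hyperplane l j. lam j)"
    using J(1) lam_bounds by (intro sum_mono2) (auto simp: X_def less_imp_le)
  also have "\<dots> < real (codim X)" by (rule lam_flats[OF flat X0 XU])
  finally show ?thesis by (simp add: cod)
qed

text \<open>The general result concerns a set of weighted vectors. As the hyperplanes are distinct,
  \<open>normal\<close> is injective and carries the weights over.\<close>

lemma W_annulus_finite:
  "(\<integral>\<^sup>+x. indicator {1..exp 1} (norm x) * ennreal (W x) \<partial>lborel) < \<infinity>"
proof -
  define lam' where "lam' = lam \<circ> the_inv_into {1..m} normal"
  have lam': "lam' (normal j) = lam j" if "j \<in> {1..m}" for j
    unfolding lam'_def o_def the_inv_into_f_f[OF inj_on_normal that] ..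
  have "(\<integral>\<^sup>+x. indicator {x. 1 \<le> norm x \<and> norm x \<le> exp 1} x *
     ennreal (\<Prod>v\<in>normal ` {1..m}. \<bar>v \<bullet> x\<bar> powr (- lam' v)) \<partial>lborel) < \<infinity>"
  proof (rule prod_powr_annulus_finite)
    fix S and x :: "real^'n"
    assume S: "S \<subseteq> normal ` {1..m}" "S \<noteq> {}" and x: "x \<noteq> 0" "\<And>v. v \<in> S \<Longrightarrow> v \<bullet> x = 0"
    obtain J where J: "J \<subseteq> {1..m}" "S = normal ` J" using S(1) by (auto simp: subset_image_iff)
    have "(\<Sum>j\<in>J. lam j) < real (dim (normal ` J))"
    proof (rule sum_lam_less_dim[OF J(1) _ x(1)])
      show "l j x = 0" if "j \<in> J" for j using that x(2)[of "normal j"] J l_eq_inner[of j x] by auto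
    qed (use S J in auto)
    moreover have "(\<Sum>v\<in>S. lam' v) = (\<Sum>j\<in>J. lam j)"
      unfolding J(2) using J(1) lam' inj_on_subset[OF inj_on_normal J(1)]
      by (subst sum.reindex) (auto intro!: sum.cong)
    ultimately show "(\<Sum>v\<in>S. lam' v) < real (dim S)" by (simp add: J(2))
  qed auto
  also have "(\<lambda>x. \<Prod>v\<in>normal ` {1..m}. \<bar>v \<bullet> x\<bar> powr (- lam' v)) = W"
    unfolding arrangement_weight_def
    by (subst prod.reindex[OF inj_on_normal]) (auto simp: fun_eq_iff lam' l_eq_inner intro!: prod.cong)
  also have "(\<lambda>x. indicator {x. 1 \<le> norm x \<and> norm x \<le> exp 1} x * ennreal (W x)) =
      (\<lambda>x. indicator {1..exp 1} (norm x) * ennreal (W x))"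
    by (auto simp: indicator_def)
  finally show ?thesis .
qed

lemma AE_off_hyperplanes: "AE x in lborel. \<forall>j\<in>{1..m}. l j x \<noteq> 0"
proof (rule AE_finite_allI)
  fix j assume "j \<in> {1..m}"
  then show "AE x in lborel. l j x \<noteq> 0"
    using AE_lborel_inner_nonzero[OF normal_nonzero[of j]] by (simp add: l_eq_inner)
qed simp

lemma chamber_unique:
  assumes "D \<in> chambers \<A>" "D' \<in> chambers \<A>" "x \<in> D" "x \<in> D'"
  shows "D = D'"
  using chamber_eq_sign_cell[OF lin assms(1,3)] chamber_eq_sign_cell[OF lin assms(2,4)] by blast

lemma two_le_m: "2 \<le> m"
proof (rule ccontr)
  assume "\<not> 2 \<le> m"
  then have "m = 0 \<or> m = 1" by auto
  then have "(\<Sum>j=1..m. lam j) < 1" using lam_bounds[of 1] by auto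
  then show False using lam_sum zero_less_card_finite[where 'a='n] by simp
qed

lemma zero_not_in_chamber: "D \<in> chambers \<A> \<Longrightarrow> 0 \<notin> D"
  using chamber_form_nonzero[of D 0 1] linear_0[OF lin[of 1]] two_le_m by auto

text \<open>The combination of two normals that vanishes at \<open>c\<close>; were it zero, the two
  forms would be proportional and their hyperplanes equal. It serves later as a cut-off form that is
  constant on lines parallel to \<open>c\<close>.\<close>

lemma ex_orthogonal_direction:
  assumes "\<And>j. j \<in> {1..m} \<Longrightarrow> l j c \<noteq> 0"
  obtains h where "h \<noteq> 0" "h \<bullet> c = 0"
proof -
  have j12: "1 \<in> {1..m}" "2 \<in> {1..m}" using two_le_m by auto
  define h where "h = l 2 c *\<^sub>R normal 1 - l 1 c *\<^sub>R normal 2"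
  have "h \<noteq> 0"
  proof
    assume "h = 0"
    then have "h \<bullet> x = 0" for x by simp
    then have eq: "l 2 c * l 1 x = l 1 c * l 2 x" for x
      unfolding h_def inner_diff_left inner_scaleR_left l_eq_inner[OF j12(1)] l_eq_inner[OF j12(2)]
      by (metis right_minus_eq)
    have "l 1 x = 0 \<longleftrightarrow> l 2 x = 0" for x
      using eq[of x] assms[OF j12(1)] assms[OF j12(2)] by (metis mult_eq_0_iff)
    then have "hyperplane l 1 = hyperplane l 2" by (simp add: hyperplane_def)
    then show False using distinct j12 by (auto dest: inj_onD)
  qed
  moreover have "h \<bullet> c = 0"
    using j12 by (simp add: h_def l_eq_inner inner_diff_left)
  ultimately show thesis by (rule that)
qed

text \<open>\<open>h\<close> and \<open>c\<close> are nonzero and orthogonal, hence independent.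
  This puts the sum of the exponents above 1, the decay needed for the line integrals.\<close>

lemma two_le_dim: "2 \<le> CARD('n)" if "D \<in> chambers \<A>"
proof -
  obtain c where c: "c \<in> D" using chamber_nonempty[OF \<open>D \<in> chambers \<A>\<close>] by blast
  obtain h where h: "h \<noteq> 0" "h \<bullet> c = 0"
    using ex_orthogonal_direction[of c] chamber_form_nonzero[OF \<open>D \<in> chambers \<A>\<close> c] by blast
  have c0: "c \<noteq> 0" using zero_not_in_chamber[OF \<open>D \<in> chambers \<A>\<close>] c by auto
  have "h \<noteq> c" using h by auto
  have "independent {h, c}"
    using h c0 by (intro pairwise_orthogonal_independent)
      (auto simp: pairwise_def orthogonal_def inner_commute)
  then have "card {h, c} \<le> DIM(real^'n)" using independent_bound by blast
  then show ?thesis using \<open>h \<noteq> c\<close> by simp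
qed

lemma chamber_period_finite:
  assumes D: "D \<in> chambers \<A>"
  shows "chamber_period l lam m D < \<infinity>"
proof -
  have "AE x in lborel. 0 < norm (x :: real^'n)" using AE_lborel_singleton[of 0] by simp
  then have "chamber_period l lam m D =
      (\<integral>\<^sup>+x. indicator {1..exp 1} (norm x) * (ennreal (W x) * indicator D x) \<partial>lborel)"
    by (intro chamber_period_eq[OF D]) auto
  also have "\<dots> \<le> (\<integral>\<^sup>+x. indicator {1..exp 1} (norm x) * ennreal (W x) \<partial>lborel)"
    by (intro nn_integral_mono) (auto simp: indicator_def)
  also have "\<dots> < \<infinity>" by (rule W_annulus_finite)
  finally show ?thesis .
qed

lemma W_pos: "(\<And>j. j \<in> {1..m} \<Longrightarrow> l j x \<noteq> 0) \<Longrightarrow> 0 < W x"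
  unfolding arrangement_weight_def by (intro prod_pos) auto

text \<open>The radial integrand is positive on the open set \<open>D \<inter> ball 0 1\<close>,
  which is nonempty since \<open>D\<close> is a cone; a zero integral would make this set
  negligible.\<close>

lemma chamber_period_pos:
  assumes D: "D \<in> chambers \<A>"
  shows "0 < chamber_period l lam m D"
proof (rule ccontr)
  have [measurable]: "D \<in> sets borel" using open_chamber[OF D] by simp
  let ?g = "\<lambda>x::real^'n. ennreal (real CARD('n) * norm x ^ CARD('n)) * indicator {..1} (norm x) *
       (ennreal (W x) * indicator D x)"
  assume "\<not> 0 < chamber_period l lam m D"
  then have "integral\<^sup>N lborel ?g = 0" using chamber_period_eq_radial[OF D] by simp
  moreover have "?g \<in> borel_measurable lborel"
    by (intro borel_measurable_times_ennreal borel_measurable_indicator') auto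
  ultimately have AE0: "AE x in lborel. ?g x = 0" by (subst (asm) nn_integral_0_iff_AE) auto
  let ?U = "D \<inter> ball 0 1"
  have nz: "?g x \<noteq> 0" if "x \<in> ?U" for x
  proof -
    have "x \<noteq> 0" using that zero_not_in_chamber[OF D] by auto
    moreover have "0 < W x" using that chamber_form_nonzero[OF D] by (intro W_pos) auto
    ultimately show ?thesis using that by (simp add: less_imp_neq[symmetric])
  qed
  have "AE x in lborel. x \<notin> ?U"
    using AE0 by eventually_elim (use nz in blast)
  moreover have "?U \<in> sets lborel" by simp
  ultimately have "?U \<in> null_sets lborel" by (simp add: AE_iff_null_sets)
  then have "negligible ?U"
    using \<open>?U \<in> sets lborel\<close> by (simp add: negligible_iff_null_sets null_sets_completion_iff)
  moreover have "?U \<noteq> {}"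
  proof -
    obtain x where x: "x \<in> D" using chamber_nonempty[OF D] by blast
    then have "x \<noteq> 0" using zero_not_in_chamber[OF D] by auto
    then have "(inverse (2 * norm x)) *\<^sub>R x \<in> ?U"
      using chamber_cone[OF D, of "inverse (2 * norm x)" x] x by simp
    then show ?thesis by blast
  qed
  ultimately show False using open_not_negligible[of ?U] open_chamber[OF D] by auto
qed

section \<open>The linear relations between the periods\<close>

text \<open>\<open>sgn (l j c)\<close> makes every form positive on \<open>C\<close>, so at
  \<open>x\<close> in \<open>D\<close> an argument is negative exactly when its hyperplane
  separates. The factor then carries the phase \<open>exp (pi * \<i> * lam j) = a j\<close>, and
  otherwise none.\<close>

lemma prod_lower_powr_eq_V:
  assumes C: "C \<in> chambers \<A>" "c \<in> C" and D: "D \<in> chambers \<A>" "x \<in> D"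
    and a: "\<And>j. j \<in> {1..m} \<Longrightarrow> a j = exp (complex_of_real pi * \<i> * complex_of_real (lam j))"
  shows "(\<Prod>j=1..m. lower_powr (of_real (sgn (l j c) * l j x)) (- lam j)) =
    V_matrix l m a C D * of_real (W x)"
proof -
  have Sep: "hyperplane l j \<in> Sep \<A> C D \<longleftrightarrow> l j c * l j x < 0" if "j \<in> {1..m}" for j
    using separates_hyperplane_iff[OF lin that C D] that by (simp add: Sep_def arrangement_def)
  have factor: "lower_powr (of_real (sgn (l j c) * l j x)) (- lam j) =
      (if hyperplane l j \<in> Sep \<A> C D then a j else 1) * of_real (\<bar>l j x\<bar> powr (- lam j))"
    if j: "j \<in> {1..m}" for j
  proof -
    have nz: "l j c \<noteq> 0" "l j x \<noteq> 0" using chamber_form_nonzero C D j by blast+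
    let ?t = "sgn (l j c) * l j x"
    have abs_t: "\<bar>?t\<bar> = \<bar>l j x\<bar>" using nz by (simp add: abs_mult abs_sgn_eq)
    show ?thesis
    proof (cases "l j c * l j x < 0")
      case True
      then have "?t < 0" by (auto simp: sgn_if mult_less_0_iff)
      then have "lower_powr (of_real ?t) (- lam j) =
          exp (- (of_real pi * \<i> * of_real (- lam j))) * of_real (\<bar>?t\<bar> powr (- lam j))"
        by (rule lower_powr_of_real_neg)
      then show ?thesis using True by (simp only: abs_t Sep[OF j] a[OF j]) simp
    next
      case False
      then have "?t > 0" using nz by (auto simp: sgn_if mult_less_0_iff not_less)
      then have "lower_powr (of_real ?t) (- lam j) = of_real (\<bar>?t\<bar> powr (- lam j))"
        by (subst lower_powr_of_real_pos) simp_all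
      then show ?thesis using False by (simp only: abs_t Sep[OF j]) simp
    qed
  qed
  have "(\<Prod>j=1..m. lower_powr (of_real (sgn (l j c) * l j x)) (- lam j)) =
     (\<Prod>j=1..m. (if hyperplane l j \<in> Sep \<A> C D then a j else 1) * of_real (\<bar>l j x\<bar> powr (- lam j)))"
    by (rule prod.cong[OF refl factor])
  also have "\<dots> = (\<Prod>j=1..m. if hyperplane l j \<in> Sep \<A> C D then a j else 1) * of_real (W x)"
    by (simp only: arrangement_weight_def prod.distrib of_real_prod)
  also have "(\<Prod>j=1..m. if hyperplane l j \<in> Sep \<A> C D then a j else 1) = V_matrix l m a C D"
    unfolding V_matrix_def by (rule prod.inter_filter[symmetric]) simp
  finally show ?thesis .
qed

lemma sum_V_matrix_chamber_period:
  assumes C: "C \<in> chambers \<A>"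
    and a: "\<And>j. j \<in> {1..m} \<Longrightarrow> a j = exp (complex_of_real pi * \<i> * complex_of_real (lam j))"
  shows "(\<Sum>D\<in>chambers \<A>. V_matrix l m a C D * complex_of_real (enn2real (chamber_period l lam m D))) = 0"
proof -
  obtain c where c: "c \<in> C" using chamber_nonempty[OF C] by blast
  have lc: "l j c \<noteq> 0" if "j \<in> {1..m}" for j using chamber_form_nonzero[OF C c that] .
  have c0: "c \<noteq> 0" using c zero_not_in_chamber[OF C] by auto
  obtain h where h: "h \<noteq> 0" "h \<bullet> c = 0" using ex_orthogonal_direction lc by blast
  \<comment> \<open>Since \<open>h \<bullet> c = 0\<close>, this cut-off is constant on the lines
    parallel to \<open>c\<close>.\<close>
  define \<eta> where "\<eta> = (\<lambda>x. indicator {1..exp 1} \<bar>h \<bullet> x\<bar> :: real)"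
  define F where "F = (\<lambda>x. \<Prod>j=1..m. lower_powr (of_real (sgn (l j c) * l j x)) (- lam j))"
  define g where "g = (\<lambda>D x. \<eta> x * (W x * indicator D x))"
  define f where "f = (\<lambda>x. of_real (\<eta> x) * F x)"
  have [measurable]: "\<eta> \<in> borel_measurable borel" unfolding \<eta>_def by measurable
  have [measurable]: "F \<in> borel_measurable borel"
    unfolding F_def
  proof (rule borel_measurable_prod)
    fix j assume "j \<in> {1..m}"
    note [measurable] = measurable_l[OF this]
    show "(\<lambda>x. lower_powr (of_real (sgn (l j c) * l j x)) (- lam j)) \<in> borel_measurable borel"
      by measurable
  qed
  have [measurable]: "f \<in> borel_measurable borel" unfolding f_def by measurable
  have "AE x in lborel. \<bar>h \<bullet> x\<bar> > 0" using AE_lborel_inner_nonzero[OF h(1)] by simp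
  then have period: "chamber_period l lam m D = (\<integral>\<^sup>+x. ennreal (g D x) \<partial>lborel)" if "D \<in> chambers \<A>" for D
  proof (subst chamber_period_eq[OF that, of "\<lambda>x. \<bar>h \<bullet> x\<bar>"])
    show "(\<integral>\<^sup>+x. indicator {1..exp 1} \<bar>h \<bullet> x\<bar> * (ennreal (W x) * indicator D x) \<partial>lborel) =
      (\<integral>\<^sup>+x. ennreal (g D x) \<partial>lborel)"
      by (intro nn_integral_cong) (auto simp: g_def \<eta>_def indicator_def)
  qed (auto simp: abs_mult)
  have g0: "0 \<le> g D x" for D x by (auto simp: g_def \<eta>_def W_nonneg)
  have gm: "g D \<in> borel_measurable borel" if "D \<in> chambers \<A>" for D
  proof -
    have [measurable]: "D \<in> sets borel" using open_chamber[OF that] by simp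
    show ?thesis unfolding g_def by measurable
  qed
  have gi: "integrable lborel (g D)" if "D \<in> chambers \<A>" for D
    using chamber_period_finite[OF that] gm[OF that] g0
    by (intro integrableI_nonneg) (auto simp: period[OF that])
  have gint: "(\<integral>x. g D x \<partial>lborel) = enn2real (chamber_period l lam m D)" if "D \<in> chambers \<A>" for D
    using gm[OF that] g0 by (subst integral_eq_nn_integral) (auto simp: period[OF that])
  have fin: "finite (chambers \<A>)" using lin by (rule finite_chambers)
  \<comment> \<open>Off the hyperplanes a point lies in exactly one chamber, so one term of the sum
    survives, and its phase and weight combine to \<open>F\<close>.\<close>
  have AEf: "AE x in lborel. (\<Sum>D\<in>chambers \<A>. V_matrix l m a C D * of_real (g D x)) = f x"
    using AE_off_hyperplanes
  proof eventually_elim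
    case (elim x)
    then obtain D0 where D0: "D0 \<in> chambers \<A>" "x \<in> D0" using ex_chamber by blast
    have "(\<Sum>D\<in>chambers \<A>. V_matrix l m a C D * of_real (g D x)) =
        (\<Sum>D\<in>chambers \<A>. if D = D0 then V_matrix l m a C D * of_real (g D x) else 0)"
      using chamber_unique[OF D0(1) _ D0(2)] by (intro sum.cong) (auto simp: g_def indicator_def)
    also have "\<dots> = V_matrix l m a C D0 * of_real (g D0 x)"
      using fin D0 by simp
    also have "\<dots> = f x"
      using prod_lower_powr_eq_V[OF C c D0 a] D0 by (simp add: f_def F_def g_def)
    finally show ?case .
  qed
  have sum_int: "integrable lborel (\<lambda>x. \<Sum>D\<in>chambers \<A>. V_matrix l m a C D * of_real (g D x))"
    using gi by (intro Bochner_Integration.integrable_sum integrable_mult_right integrable_of_real)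
  have fi: "integrable lborel f"
    using sum_int AEf by (subst integrable_cong_AE[symmetric]) auto
  have "(\<Sum>D\<in>chambers \<A>. V_matrix l m a C D * complex_of_real (enn2real (chamber_period l lam m D))) =
      (\<Sum>D\<in>chambers \<A>. \<integral>x. V_matrix l m a C D * of_real (g D x) \<partial>lborel)"
    by (intro sum.cong refl) (simp add: gint)
  also have "\<dots> = (\<integral>x. (\<Sum>D\<in>chambers \<A>. V_matrix l m a C D * of_real (g D x)) \<partial>lborel)"
    using gi by (intro Bochner_Integration.integral_sum[symmetric] integrable_mult_right integrable_of_real)
  also have "\<dots> = (\<integral>x. f x \<partial>lborel)"
    using AEf sum_int by (intro integral_cong_AE) auto
  also have "\<dots> = 0"
  \<comment> \<open>The direction is \<open>- c\<close> so that on each line every argument is a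
    constant minus \<open>s * \<bar>l j c\<bar>\<close>, the form for which the line integral
    vanishes.\<close>
  proof (rule integral_zero_if_line_integrals_zero[OF fi, where c = "- c" and k = "- (c /\<^sub>R (c \<bullet> c))"])
    show "- (c /\<^sub>R (c \<bullet> c)) \<bullet> - c = 1" using c0 by simp
    fix y assume int: "integrable lborel (\<lambda>s. f (y + s *\<^sub>R - c))"
    have \<eta>y: "\<eta> (y + s *\<^sub>R - c) = \<eta> y" for s
      using h(2) by (simp add: \<eta>_def inner_diff_right)
    show "(\<integral>s. f (y + s *\<^sub>R - c) \<partial>lborel) = 0"
    proof (cases "\<eta> y = 0")
      case True
      then show ?thesis by (simp only: f_def \<eta>y) simp
    next
      case False
      then have "\<eta> y = 1" by (auto simp: \<eta>_def indicator_def split: if_splits)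
      then have fF: "f (y + s *\<^sub>R - c) = (\<Prod>j\<in>{1..m}.
          lower_powr (of_real (sgn (l j c) * l j y - s * (sgn (l j c) * l j c))) (- lam j))" for s
        unfolding f_def F_def \<eta>y
        by (simp, intro prod.cong refl arg_cong2[where f = lower_powr])
           (auto simp: linear_diff[OF lin] linear_scale[OF lin] algebra_simps)
      show ?thesis
        unfolding fF
      proof (rule integral_line_prod_lower_powr_zero)
        show "integrable lborel (\<lambda>s. \<Prod>j\<in>{1..m}.
          lower_powr (of_real (sgn (l j c) * l j y - s * (sgn (l j c) * l j c))) (- lam j))"
          using int unfolding fF .
        show "1 < (\<Sum>j\<in>{1..m}. lam j)" using two_le_dim[OF C] lam_sum by simp
        show "0 < sgn (l j c) * l j c" if "j \<in> {1..m}" for j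
          using lc[OF that] by (auto simp: sgn_if)
      qed (use lam_bounds in auto)
    qed
  qed
  finally show ?thesis .
qed

end

theorem theorem5p2:
  fixes l :: "nat \<Rightarrow> real^'n \<Rightarrow> real" and m :: nat
    and lam :: "nat \<Rightarrow> real" and a :: "nat \<Rightarrow> complex"
  assumes linear: "\<And>j. j \<in> {1..m} \<Longrightarrow> linear (l j)"
    and nonzero: "\<And>j. j \<in> {1..m} \<Longrightarrow> l j \<noteq> (\<lambda>x. 0)"
    and distinct: "inj_on (hyperplane l) {1..m}"
    and essential: "essential (arrangement l m)"
    and lam_bounds: "\<And>j. j \<in> {1..m} \<Longrightarrow> 0 < lam j \<and> lam j < 1"
    and lam_sum: "(\<Sum>j=1..m. lam j) = real CARD('n)"
    and lam_flats: "\<And>X. X \<in> intersection_flats (arrangement l m) \<Longrightarrow> X \<noteq> {0} \<Longrightarrow> X \<noteq> UNIV \<Longrightarrow>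
          (\<Sum>j | j \<in> {1..m} \<and> X \<subseteq> hyperplane l j. lam j) < real (codim X)"
    and a_def: "\<And>j. j \<in> {1..m} \<Longrightarrow> a j = exp (complex_of_real pi * \<i> * complex_of_real (lam j))"
  shows "(\<forall>D\<in>chambers (arrangement l m).
            0 < chamber_period l lam m D \<and> chamber_period l lam m D < \<infinity>) \<and>
         (\<forall>C\<in>chambers (arrangement l m).
            (\<Sum>D\<in>chambers (arrangement l m).
               V_matrix l m a C D * complex_of_real (enn2real (chamber_period l lam m D))) = 0)"
proof -
  interpret balanced_arrangement l m lam
    using linear nonzero distinct lam_bounds lam_sum lam_flats by (rule balanced_arrangement.intro)
  show ?thesis
    using chamber_period_pos chamber_period_finite sum_V_matrix_chamber_period[OF _ a_def] by blast
qed

end
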